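(* Let $\mathbb{V}$ be a $6$-dimensional real vector space with an inner product $\langle -,-\rangle$ of euclidean or lorentzian signature, and let $F\in\Lambda^3\mathbb{V}^*$. Then $[\iota_X F, F]=0$ for all $X\in\mathbb{V}$ if and only if $F=F_1+F_2$ for some simple $3$-forms $F_1,F_2\in\Lambda^3\mathbb{V}^*$ which are orthogonal to each other.
   Context: An inner product is a nondegenerate symmetric bilinear form; euclidean means positive-definite, and lorentzian means of signature $(1,\dim\mathbb{V}-1)$ (one timelike direction). $\iota_X F$ is the $2$-form $F(X,-,-)$. A $2$-form $\omega\in\Lambda^2\mathbb{V}^*\cong\mathfrak{so}(\mathbb{V})$ acts on forms $\Omega\in\Lambda\mathbb{V}^*$ by $[\omega,\Omega]$, defined for $\omega=\alpha\wedge\beta$ with $\alpha,\beta\in\mathbb{V}^*$ by $$[\alpha\wedge\beta,\Omega]=\alpha\wedge\iota_{\beta^\sharp}\Omega-\beta\wedge\iota_{\alpha^\sharp}\Omega$$ and extended linearly in $\omega$, where $\alpha^\sharp\in\mathbb{V}$ is the vector dual to $\alpha$ under the inner product. A $p$-form is simple if it can be written as a wedge product of $p$ one-forms. A nonzero simple form determines a $p$-plane, the span of those one-forms, regarded as a subspace $\Pi\subset\mathbb{V}$ using the inner product to identify $\mathbb{V}^*$ with $\mathbb{V}$. Two nonzero simple $p$-forms are orthogonal if their planes satisfy $\langle X_1,X_2\rangle=0$ for all $X_1\in\Pi_1$, $X_2\in\Pi_2$; in lorentzian signature the planes may share a null direction. The zero form counts as simple and as orthogonal to every simple form (so $F$ simple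 is allowed as a degenerate case). *)

theory Defs
  imports "HOL-Analysis.Analysis" "HOL-Library.Function_Algebras"
begin

section \<open>Inner products\<close>

definition inner_product :: "('v::real_vector \<Rightarrow> 'v \<Rightarrow> real) \<Rightarrow> bool" where
  "inner_product B \<longleftrightarrow>
     bilinear B \<and> (\<forall>u v. B u v = B v u) \<and> (\<forall>u. (\<forall>v. B u v = 0) \<longrightarrow> u = 0)"

definition euclidean_signature :: "('v::real_vector \<Rightarrow> 'v \<Rightarrow> real) \<Rightarrow> bool" where
  "euclidean_signature B \<longleftrightarrow> (\<forall>v. v \<noteq> 0 \<longrightarrow> B v v > 0)"

text \<open>
  Signature \<open>(t, s)\<close>: there is a basis of pairwise orthogonal vectors, \<open>t\<close> of square \<open>- 1\<close>
  (timelike) and \<open>s\<close> of square \<open>1\<close> (spacelike). The sign is the one for which a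
  positive-definite inner product has no timelike directions.
\<close>

definition has_signature :: "('v::real_vector \<Rightarrow> 'v \<Rightarrow> real) \<Rightarrow> nat \<Rightarrow> nat \<Rightarrow> bool" where
  "has_signature B t s \<longleftrightarrow>
     (\<exists>T S. finite T \<and> finite S \<and> T \<inter> S = {} \<and> card T = t \<and> card S = s \<and>
        independent (T \<union> S) \<and> span (T \<union> S) = UNIV \<and>
        (\<forall>u\<in>T \<union> S. \<forall>v\<in>T \<union> S. u \<noteq> v \<longrightarrow> B u v = 0) \<and>
        (\<forall>v\<in>T. B v v = - 1) \<and> (\<forall>v\<in>S. B v v = 1))"

definition lorentzian_signature :: "('v::real_vector \<Rightarrow> 'v \<Rightarrow> real) \<Rightarrow> bool" where
  "lorentzian_signature B \<longleftrightarrow> has_signature B 1 (dim (UNIV :: 'v set) - 1)"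

text \<open>The vector dual to a one-form.\<close>

definition sharp :: "('v::real_vector \<Rightarrow> 'v \<Rightarrow> real) \<Rightarrow> ('v \<Rightarrow> real) \<Rightarrow> 'v" where
  "sharp B \<alpha> = (THE u. \<forall>v. B u v = \<alpha> v)"


section \<open>Exterior forms\<close>

text \<open>
  A \<open>p\<close>-form is an alternating multilinear function of \<open>p\<close> vectors. The arguments are
  collected in a list, and a \<open>p\<close>-form is set to \<open>0\<close> on lists of any other length.
  One-forms that enter wedge products are kept as linear functionals \<open>'v \<Rightarrow> real\<close>.
\<close>

type_synonym 'v form = "'v list \<Rightarrow> real"

definition forms :: "nat \<Rightarrow> 'v::real_vector form set" where
  "forms p = {\<omega>. (\<forall>vs. length vs \<noteq> p \<longrightarrow> \<omega> vs = 0) \<and>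
     (\<forall>vs i. length vs = p \<longrightarrow> i < p \<longrightarrow> linear (\<lambda>x. \<omega> (vs[i := x]))) \<and>
     (\<forall>vs. length vs = p \<longrightarrow> \<not> distinct vs \<longrightarrow> \<omega> vs = 0)}"

definition interior :: "'v \<Rightarrow> 'v form \<Rightarrow> 'v form" (\<open>\<iota>\<close>) where
  "\<iota> X \<omega> = (\<lambda>vs. \<omega> (X # vs))"

text \<open>
  The wedge product of a one-form with a form, in the normalization
  \<open>(\<alpha> \<and> \<beta>)(u, v) = \<alpha>(u) \<beta>(v) - \<alpha>(v) \<beta>(u)\<close>, for which contraction is an antiderivation.
\<close>

definition wedge :: "('v \<Rightarrow> real) \<Rightarrow> 'v form \<Rightarrow> 'v form" (infixr \<open>\<odot>\<close> 75) where
  "\<alpha> \<odot> \<omega> = (\<lambda>vs. \<Sum>i<length vs. (- 1) ^ i * \<alpha> (vs ! i) * \<omega> (take i vs @ drop (Suc i) vs))"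

definition unit_form :: "'v form" where
  "unit_form = (\<lambda>vs. if vs = [] then 1 else 0)"

definition wedge_list :: "('v \<Rightarrow> real) list \<Rightarrow> 'v form" where
  "wedge_list \<alpha>s = foldr wedge \<alpha>s unit_form"

definition simple_form :: "nat \<Rightarrow> 'v::real_vector form \<Rightarrow> bool" where
  "simple_form p \<omega> \<longleftrightarrow>
     (\<exists>\<alpha>s. length \<alpha>s = p \<and> (\<forall>\<alpha>\<in>set \<alpha>s. linear \<alpha>) \<and> \<omega> = wedge_list \<alpha>s)"

text \<open>
  The plane of a nonzero simple form; \<open>form_plane_wedge_list\<close> below shows that it does not
  depend on the factorization.
\<close>

definition form_plane :: "('v::real_vector \<Rightarrow> 'v \<Rightarrow> real) \<Rightarrow> 'v form \<Rightarrow> 'v set" where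
  "form_plane B \<omega> =
     (THE P. \<exists>\<alpha>s. (\<forall>\<alpha>\<in>set \<alpha>s. linear \<alpha>) \<and> \<omega> = wedge_list \<alpha>s \<and> P = span (sharp B ` set \<alpha>s))"

definition orthogonal_forms ::
    "('v::real_vector \<Rightarrow> 'v \<Rightarrow> real) \<Rightarrow> 'v form \<Rightarrow> 'v form \<Rightarrow> bool" where
  "orthogonal_forms B \<omega> \<eta> \<longleftrightarrow>
     \<omega> = 0 \<or> \<eta> = 0 \<or> (\<forall>X\<in>form_plane B \<omega>. \<forall>Y\<in>form_plane B \<eta>. B X Y = 0)"

text \<open>
  The action \<open>[\<omega>, \<Omega>]\<close> of a two-form, given on \<open>\<omega> = \<alpha> \<and> \<beta>\<close> and extended linearly: \<open>\<omega>\<close> is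
  written as a finite sum of such products (scalars are absorbed into the factors).
  Independence of that choice is \<open>bracket_sum_list\<close> below, existence is \<open>two_form_sum_list\<close>.
\<close>

definition bracket ::
    "('v::real_vector \<Rightarrow> 'v \<Rightarrow> real) \<Rightarrow> 'v form \<Rightarrow> 'v form \<Rightarrow> 'v form" where
  "bracket B \<omega> \<Omega> =
     (THE \<Theta>. \<exists>ps. (\<forall>(\<alpha>, \<beta>)\<in>set ps. linear \<alpha> \<and> linear \<beta>) \<and>
        \<omega> = (\<Sum>(\<alpha>, \<beta>)\<leftarrow>ps. wedge_list [\<alpha>, \<beta>]) \<and>
        \<Theta> = (\<Sum>(\<alpha>, \<beta>)\<leftarrow>ps. \<alpha> \<odot> \<iota> (sharp B \<beta>) \<Omega> - \<beta> \<odot> \<iota> (sharp B \<alpha>) \<Omega>))"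


section \<open>Well-definedness\<close>

subsection \<open>The vector dual to a one-form\<close>

lemma sharp_unique:
  assumes "inner_product B" and "\<And>v. B u v = \<alpha> v"
  shows "sharp B \<alpha> = u"
  unfolding sharp_def
proof (rule the_equality)
  show "\<forall>v. B u v = \<alpha> v" using assms(2) by blast
next
  fix w assume "\<forall>v. B w v = \<alpha> v"
  then have "\<forall>v. B (w - u) v = 0"
    using assms bilinear_lsub[of B w u] by (simp add: inner_product_def)
  then have "w - u = 0" using assms(1) unfolding inner_product_def by blast
  then show "w = u" by simp
qed

lemma inner_sharp:
  fixes B :: "'v::real_vector \<Rightarrow> 'v \<Rightarrow> real"
  assumes B: "inner_product B" and fin: "0 < dim (UNIV :: 'v set)" and lin: "linear \<alpha>"
  shows "B (sharp B \<alpha>) v = \<alpha> v"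
proof -
  obtain b :: "'v set" where b: "independent b" "span b = UNIV" "card b = dim (UNIV :: 'v set)"
    using basis_exists[of "UNIV :: 'v set"] by (metis top.extremum_uniqueI)
  then have finb: "finite b" using fin card_gt_0_iff by metis
  interpret fd: finite_dimensional_vector_space "scaleR :: real \<Rightarrow> 'v \<Rightarrow> 'v" b
    using b finb by unfold_locales (auto simp: span_raw_def dependent_raw_def)
  have linB: "linear (\<lambda>y. B x y)" "linear (\<lambda>x. B x y)" for x y
    using B by (auto simp: inner_product_def bilinear_def)
  define f where "f u = (\<Sum>e\<in>b. B u e *\<^sub>R e)" for u
  have eq: "g = h" if "linear g" "linear h" "\<And>e. e \<in> b \<Longrightarrow> g e = h e" for g h :: "'v \<Rightarrow> real"
    using linear_eq_on_span[OF that] b(2) by auto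
  have coeff: "\<forall>e\<in>b. c e = d e" if "(\<Sum>e\<in>b. c e *\<^sub>R e) = (\<Sum>e\<in>b. d e *\<^sub>R e)" for c d :: "'v \<Rightarrow> real"
  proof -
    have "(\<Sum>e\<in>b. (c e - d e) *\<^sub>R e) = 0"
      using that by (simp add: scaleR_diff_left sum_subtractf)
    then show ?thesis using b(1) finb independentD[of b b "\<lambda>e. c e - d e"] by force
  qed
  have "linear f" unfolding f_def
    by (rule linearI) (simp_all add: linear_add[OF linB(2)] linear_cmul[OF linB(2)]
        scaleR_add_left sum.distrib scaleR_sum_right)
  moreover have "inj f"
    unfolding linear_injective_0[OF \<open>linear f\<close>]
  proof (intro allI impI)
    fix u assume "f u = 0"
    then have "\<forall>e\<in>b. B u e = 0" using coeff[of "B u" "\<lambda>_. 0"] by (simp add: f_def)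
    then have "B u = (\<lambda>_. 0)" using eq[OF linB(1)] linear_zero by blast
    then show "u = 0" using B by (simp add: inner_product_def)
  qed
  ultimately have "surj f"
    using fd.linear_inj_imp_surj[of f] by (simp add: linear_def)
  then obtain u where "f u = (\<Sum>e\<in>b. \<alpha> e *\<^sub>R e)" by (metis surjD)
  then have "B u = \<alpha>" using coeff eq[OF linB(1) lin] unfolding f_def by blast
  then show ?thesis using sharp_unique[OF B, of u \<alpha>] by simp
qed


subsection \<open>Wedge products\<close>

lemma wedge_Nil [simp]: "(\<alpha> \<odot> \<omega>) [] = 0"
  by (simp add: wedge_def)

lemma wedge_Cons: "(\<alpha> \<odot> \<omega>) (v # vs) = \<alpha> v * \<omega> vs - (\<alpha> \<odot> \<iota> v \<omega>) vs"
  unfolding wedge_def interior_def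
  by (simp add: sum.lessThan_Suc_shift sum_negf flip: sum_negf del: sum.lessThan_Suc)

lemma interior_wedge: "\<iota> v (\<alpha> \<odot> \<omega>) = (\<lambda>vs. \<alpha> v * \<omega> vs - (\<alpha> \<odot> \<iota> v \<omega>) vs)"
  by (simp add: interior_def wedge_Cons fun_eq_iff)

lemma wedge_lincomb:
  "(\<alpha> \<odot> (\<lambda>vs. c * \<omega> vs - d * \<eta> vs)) vs = c * (\<alpha> \<odot> \<omega>) vs - d * (\<alpha> \<odot> \<eta>) vs"
  unfolding wedge_def by (simp add: sum_distrib_left algebra_simps flip: sum_subtractf)

lemma wedge_zero [simp]: "\<alpha> \<odot> 0 = 0"
  by (simp add: wedge_def fun_eq_iff)

lemma wedge_anticomm: "(\<alpha> \<odot> \<beta> \<odot> \<omega>) vs = - (\<beta> \<odot> \<alpha> \<odot> \<omega>) vs"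
proof (induction vs arbitrary: \<omega>)
  case (Cons v vs)
  have "(\<alpha> \<odot> \<iota> v (\<beta> \<odot> \<omega>)) vs = \<beta> v * (\<alpha> \<odot> \<omega>) vs - (\<alpha> \<odot> \<beta> \<odot> \<iota> v \<omega>) vs" for \<alpha> \<beta>
    using wedge_lincomb[of \<alpha> "\<beta> v" \<omega> 1 "\<beta> \<odot> \<iota> v \<omega>" vs] by (simp add: interior_wedge)
  then show ?case using Cons[of "\<iota> v \<omega>"] by (simp add: wedge_Cons[of _ _ v])
qed simp

lemma wedge_wedge_list_member:
  assumes "\<beta> \<in> set \<alpha>s"
  shows "\<beta> \<odot> wedge_list \<alpha>s = 0"
  using assms
proof (induction \<alpha>s)
  case (Cons \<alpha> \<alpha>s)
  have neg: "\<beta> \<odot> wedge_list (\<alpha> # \<alpha>s) = - (\<alpha> \<odot> \<beta> \<odot> wedge_list \<alpha>s)"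
    using wedge_anticomm[of \<beta> \<alpha>] by (simp add: wedge_list_def fun_eq_iff)
  show ?case
  proof (cases "\<beta> = \<alpha>")
    case True
    then have "(\<beta> \<odot> \<beta> \<odot> wedge_list \<alpha>s) vs = 0" for vs
      using wedge_anticomm[of \<beta> \<beta> "wedge_list \<alpha>s" vs] by simp
    then show ?thesis using True by (simp add: wedge_list_def fun_eq_iff)
  next
    case False
    then have "\<beta> \<odot> wedge_list \<alpha>s = 0" using Cons.prems False by (intro Cons.IH) auto
    then have "\<beta> \<odot> wedge_list (\<alpha> # \<alpha>s) = - 0" unfolding neg by (simp only: wedge_zero)
    then show ?thesis by (simp add: fun_eq_iff)
  qed
qed simp


subsection \<open>The plane of a simple form\<close>

lemma wedge_list_Cons_in_span:
  fixes B :: "'v::real_vector \<Rightarrow> 'v \<Rightarrow> real"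
  assumes B: "inner_product B" "0 < dim (UNIV :: 'v set)"
    and lin: "\<forall>\<alpha>\<in>set \<alpha>s. linear \<alpha>"
  shows "\<exists>u\<in>span (sharp B ` set \<alpha>s). \<forall>x. B u x = wedge_list \<alpha>s (x # w)"
  using lin
proof (induction \<alpha>s arbitrary: w)
  case Nil
  have "B 0 x = 0" for x using B(1) by (simp add: inner_product_def bilinear_lzero)
  then show ?case by (auto simp: wedge_list_def unit_form_def)
next
  case (Cons \<alpha> \<alpha>s)
  let ?W = "wedge_list \<alpha>s"
  have bil: "bilinear B" using B(1) by (simp add: inner_product_def)
  then have linB: "linear (\<lambda>x. B x y)" for y by (simp add: bilinear_def)
  have "\<forall>w. \<exists>u\<in>span (sharp B ` set \<alpha>s). \<forall>x. B u x = ?W (x # w)"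
    using Cons by simp
  then obtain U where U: "\<And>w. U w \<in> span (sharp B ` set \<alpha>s)" "\<And>w x. B (U w) x = ?W (x # w)"
    by metis
  define u where "u = ?W w *\<^sub>R sharp B \<alpha>
     - (\<Sum>i<length w. ((- 1) ^ i * \<alpha> (w ! i)) *\<^sub>R U (take i w @ drop (Suc i) w))"
  have "U w \<in> span (sharp B ` set (\<alpha> # \<alpha>s))" for w
    using U(1) span_mono[of "sharp B ` set \<alpha>s" "sharp B ` set (\<alpha> # \<alpha>s)"] by auto
  then have "u \<in> span (sharp B ` set (\<alpha> # \<alpha>s))"
    unfolding u_def by (intro span_diff span_scale span_sum) (auto intro: span_base)
  moreover have "B u x = wedge_list (\<alpha> # \<alpha>s) (x # w)" for x
  proof -
    have "B u x = ?W w * \<alpha> x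
        - (\<Sum>i<length w. ((- 1) ^ i * \<alpha> (w ! i)) * ?W (x # take i w @ drop (Suc i) w))"
      using Cons.prems unfolding u_def
      by (simp add: linear_diff[OF linB] linear_cmul[OF linB] linear_sum[OF linB] U(2)
          inner_sharp[OF B])
    also have "\<dots> = (\<alpha> \<odot> ?W) (x # w)"
      unfolding wedge_Cons by (simp add: wedge_def interior_def)
    finally show ?thesis by (simp add: wedge_list_def)
  qed
  ultimately show ?case by blast
qed

lemma sharp_in_span:
  fixes B :: "'v::real_vector \<Rightarrow> 'v \<Rightarrow> real"
  assumes B: "inner_product B" "0 < dim (UNIV :: 'v set)"
    and lin: "\<forall>\<alpha>\<in>set \<alpha>s. linear \<alpha>"
    and nz: "wedge_list \<alpha>s \<noteq> 0" and eq: "\<beta> \<odot> wedge_list \<alpha>s = 0"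
  shows "sharp B \<beta> \<in> span (sharp B ` set \<alpha>s)"
proof -
  let ?W = "wedge_list \<alpha>s"
  have linB: "linear (\<lambda>x. B x y)" for y using B(1) by (simp add: inner_product_def bilinear_def)
  obtain w where w: "?W w \<noteq> 0" using nz by (auto simp: fun_eq_iff)
  obtain U where U: "\<And>w. U w \<in> span (sharp B ` set \<alpha>s)" "\<And>w x. B (U w) x = ?W (x # w)"
    using wedge_list_Cons_in_span[OF B lin] by metis
  define u where "u = (1 / ?W w) *\<^sub>R
     (\<Sum>i<length w. ((- 1) ^ i * \<beta> (w ! i)) *\<^sub>R U (take i w @ drop (Suc i) w))"
  have "B u x = \<beta> x" for x
  proof -
    have "B u x = (\<beta> \<odot> \<iota> x ?W) w / ?W w"
      unfolding u_def
      by (simp add: linear_cmul[OF linB] linear_sum[OF linB] U(2) wedge_def interior_def)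
    moreover have "\<beta> x * ?W w = (\<beta> \<odot> \<iota> x ?W) w"
      using wedge_Cons[of \<beta> ?W x w] eq by (simp add: fun_eq_iff)
    ultimately show ?thesis using w by (metis nonzero_mult_div_cancel_right)
  qed
  then have "sharp B \<beta> = u" by (rule sharp_unique[OF B(1)])
  moreover have "u \<in> span (sharp B ` set \<alpha>s)"
    unfolding u_def by (intro span_scale span_sum U(1))
  ultimately show ?thesis by simp
qed

lemma form_plane_wedge_list:
  fixes B :: "'v::real_vector \<Rightarrow> 'v \<Rightarrow> real"
  assumes B: "inner_product B" "0 < dim (UNIV :: 'v set)"
    and lin: "\<forall>\<alpha>\<in>set \<alpha>s. linear \<alpha>" and nz: "wedge_list \<alpha>s \<noteq> 0"
  shows "form_plane B (wedge_list \<alpha>s) = span (sharp B ` set \<alpha>s)"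
proof -
  have le: "span (sharp B ` set \<beta>s) \<subseteq> span (sharp B ` set \<gamma>s)"
    if "\<forall>\<alpha>\<in>set \<gamma>s. linear \<alpha>" "wedge_list \<gamma>s \<noteq> 0" "wedge_list \<beta>s = wedge_list \<gamma>s" for \<beta>s \<gamma>s
  proof (rule span_minimal)
    show "sharp B ` set \<beta>s \<subseteq> span (sharp B ` set \<gamma>s)"
      using sharp_in_span[OF B that(1,2)] wedge_wedge_list_member[of _ \<beta>s] that(3) by auto
  qed (rule subspace_span)
  show ?thesis
    unfolding form_plane_def
  proof (rule the_equality)
    show "\<exists>\<beta>s. (\<forall>\<alpha>\<in>set \<beta>s. linear \<alpha>) \<and> wedge_list \<alpha>s = wedge_list \<beta>s \<and>
        span (sharp B ` set \<alpha>s) = span (sharp B ` set \<beta>s)"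
      using lin by blast
  next
    fix P
    assume "\<exists>\<beta>s. (\<forall>\<alpha>\<in>set \<beta>s. linear \<alpha>) \<and> wedge_list \<alpha>s = wedge_list \<beta>s \<and>
        P = span (sharp B ` set \<beta>s)"
    then obtain \<beta>s where \<beta>s: "\<forall>\<alpha>\<in>set \<beta>s. linear \<alpha>" "wedge_list \<alpha>s = wedge_list \<beta>s"
        "P = span (sharp B ` set \<beta>s)"
      by blast
    have "wedge_list \<beta>s \<noteq> 0" using nz \<beta>s(2) by metis
    then show "P = span (sharp B ` set \<alpha>s)"
      unfolding \<beta>s(3) using le[OF \<beta>s(1) _ \<beta>s(2)] le[OF lin nz \<beta>s(2)[symmetric]]
      by (intro subset_antisym)
  qed
qed


subsection \<open>Alternating multilinear functions\<close>

lemma forms_length: "\<omega> \<in> forms p \<Longrightarrow> length vs \<noteq> p \<Longrightarrow> \<omega> vs = 0"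
  by (simp add: forms_def)

lemma forms_not_distinct: "\<omega> \<in> forms p \<Longrightarrow> \<not> distinct vs \<Longrightarrow> \<omega> vs = 0"
  by (cases "length vs = p") (auto simp: forms_def)

lemma linear_zero_fun: "linear (\<lambda>x. 0 :: real)"
  by (rule linearI) simp_all

lemma forms_linear:
  assumes "\<omega> \<in> forms p"
  shows "linear (\<lambda>x. \<omega> (us @ x # ws))"
proof (cases "length us + Suc (length ws) = p")
  case True
  then have "length (us @ undefined # ws) = p" "length us < p" by auto
  then have "linear (\<lambda>x. \<omega> ((us @ undefined # ws)[length us := x]))"
    using assms unfolding forms_def by blast
  then show ?thesis by simp
next
  case False
  then have "(\<lambda>x. \<omega> (us @ x # ws)) = (\<lambda>x. 0)" using forms_length[OF assms] by simp
  then show ?thesis using linear_zero_fun by simp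
qed

lemma swap_adjacent:
  assumes lin: "\<And>us ws. linear (\<lambda>x. \<omega> (us @ x # ws) :: real)"
    and alt: "\<And>us x ws. \<omega> (us @ x # x # ws) = 0"
  shows "\<omega> (us @ x # y # ws) = - \<omega> (us @ y # x # ws)"
proof -
  have 1: "\<omega> (us @ (a + b) # c # ws) = \<omega> (us @ a # c # ws) + \<omega> (us @ b # c # ws)" for a b c
    using linear_add[OF lin] .
  have 2: "\<omega> (us @ c # (a + b) # ws) = \<omega> (us @ c # a # ws) + \<omega> (us @ c # b # ws)" for a b c
    using linear_add[OF lin[of "us @ [c]" ws]] by simp
  show ?thesis using alt[of us "x + y" ws] alt[of us x ws] alt[of us y ws] by (simp add: 1 2)
qed

lemma formsI:
  assumes len: "\<And>vs. length vs \<noteq> p \<Longrightarrow> \<omega> vs = 0"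
    and lin: "\<And>us ws. linear (\<lambda>x. \<omega> (us @ x # ws))"
    and alt: "\<And>us x ws. \<omega> (us @ x # x # ws) = 0"
  shows "\<omega> \<in> forms p"
proof -
  have move: "\<omega> (us @ x # ys @ x # zs) = 0" for us x ys zs
  proof (induction ys arbitrary: us)
    case (Cons y ys)
    have "\<omega> (us @ x # y # ys @ x # zs) = - \<omega> (us @ y # x # ys @ x # zs)"
      by (rule swap_adjacent[OF lin alt])
    then show ?case using Cons[of "us @ [y]"] by simp
  qed (simp add: alt)
  have "\<omega> vs = 0" if "\<not> distinct vs" for vs
    using not_distinct_decomp[OF that] move by auto
  moreover have "linear (\<lambda>x. \<omega> (vs[i := x]))" if "i < length vs" for vs i
    using lin that by (simp add: upd_conv_take_nth_drop)
  ultimately show ?thesis using len by (simp add: forms_def)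
qed

lemma forms_adjacent: "\<omega> \<in> forms p \<Longrightarrow> \<omega> (us @ x # x # ws) = 0"
  by (rule forms_not_distinct) auto

lemma interior_in_forms:
  assumes "\<omega> \<in> forms p"
  shows "\<iota> X \<omega> \<in> forms (p - 1)"
proof (rule formsI)
  show "\<iota> X \<omega> vs = 0" if "length vs \<noteq> p - 1" for vs
    using forms_length[OF assms, of "X # vs"] that by (simp add: interior_def)
  show "linear (\<lambda>x. \<iota> X \<omega> (us @ x # ws))" for us ws
    using forms_linear[OF assms, of "X # us" ws] by (simp add: interior_def)
  show "\<iota> X \<omega> (us @ x # x # ws) = 0" for us x ws
    using forms_adjacent[OF assms, of "X # us" x ws] by (simp add: interior_def)
qed

lemma wedge_in_forms:
  assumes \<alpha>: "linear \<alpha>" and \<omega>: "\<omega> \<in> forms p"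
  shows "\<alpha> \<odot> \<omega> \<in> forms (Suc p)"
proof (rule formsI)
  show "(\<alpha> \<odot> \<omega>) vs = 0" if "length vs \<noteq> Suc p" for vs
    using that unfolding wedge_def by (intro sum.neutral) (auto intro!: forms_length[OF \<omega>])
  have base: "linear (\<lambda>x. (\<alpha> \<odot> \<omega>) (x # ws))" if "\<omega> \<in> forms p" for \<omega> ws p
  proof -
    have lin: "linear (\<lambda>x. \<omega> (x # vs))" for vs using forms_linear[OF that, of "[]"] by simp
    have m: "linear (\<lambda>x. (\<alpha> \<odot> \<iota> x \<omega>) ws)"
      unfolding wedge_def interior_def
      by (rule linearI) (simp_all add: linear_add[OF lin] linear_cmul[OF lin] algebra_simps
          sum.distrib sum_distrib_left)
    show ?thesis
      by (rule linearI) (simp_all add: wedge_Cons linear_add[OF \<alpha>] linear_cmul[OF \<alpha>]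
          linear_add[OF m] linear_cmul[OF m] algebra_simps)
  qed
  show "linear (\<lambda>x. (\<alpha> \<odot> \<omega>) (us @ x # ws))" for us ws
    using \<omega>
  proof (induction us arbitrary: \<omega> p)
    case Nil
    then show ?case using base by simp
  next
    case (Cons u us)
    have l: "linear (\<lambda>x. \<omega> (us @ x # ws))" using forms_linear[OF Cons.prems] .
    have m: "linear (\<lambda>x. (\<alpha> \<odot> \<iota> u \<omega>) (us @ x # ws))"
      using Cons.IH[OF interior_in_forms[OF Cons.prems]] .
    show ?case
      by (rule linearI) (simp_all add: wedge_Cons linear_add[OF l] linear_cmul[OF l]
          linear_add[OF m] linear_cmul[OF m] algebra_simps)
  qed
  show "(\<alpha> \<odot> \<omega>) (us @ x # x # ws) = 0" for us x ws
    using \<omega>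
  proof (induction us arbitrary: \<omega> p)
    case Nil
    have "\<iota> x (\<iota> x \<omega>) = 0"
      using forms_adjacent[OF Nil, of "[]" x] by (simp add: interior_def fun_eq_iff)
    then show ?case by (simp add: wedge_Cons) (simp add: interior_def)
  next
    case (Cons u us)
    then show ?case
      using Cons.IH[OF interior_in_forms[OF Cons.prems]] forms_adjacent[OF Cons.prems]
      by (simp add: wedge_Cons)
  qed
qed

lemma unit_form_in_forms: "unit_form \<in> forms 0"
  by (rule formsI) (auto simp: unit_form_def linear_zero_fun)

lemma wedge_list_in_forms:
  "\<forall>\<alpha>\<in>set \<alpha>s. linear \<alpha> \<Longrightarrow> wedge_list \<alpha>s \<in> forms (length \<alpha>s)"
  by (induction \<alpha>s) (auto simp: wedge_list_def unit_form_in_forms wedge_in_forms)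

lemma simple_form_in_forms: "simple_form p \<omega> \<Longrightarrow> \<omega> \<in> forms p"
  unfolding simple_form_def using wedge_list_in_forms by blast


subsection \<open>The action of two-forms\<close>

lemma wedge_list_two: "wedge_list [\<alpha>, \<beta>] [u, v] = \<alpha> u * \<beta> v - \<alpha> v * \<beta> u"
  by (simp add: wedge_list_def wedge_def unit_form_def numeral_2_eq_2)

lemma forms_move:
  assumes "\<omega> \<in> forms p" and "i \<le> length vs"
  shows "\<omega> (b # vs) = (- 1) ^ i * \<omega> (take i vs @ b # drop i vs)"
  using assms(2)
proof (induction i)
  case (Suc i)
  have "take (Suc i) vs = take i vs @ [vs ! i]" "drop i vs = vs ! i # drop (Suc i) vs"
    using Suc.prems by (simp_all add: take_Suc_conv_app_nth Cons_nth_drop_Suc)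
  then show ?case
    using Suc swap_adjacent[OF forms_linear[OF assms(1)] forms_adjacent[OF assms(1)],
        of "take i vs" b "vs ! i" "drop (Suc i) vs"]
    by simp
qed simp

lemma wedge_interior_apply:
  assumes "\<Omega> \<in> forms p"
  shows "(\<alpha> \<odot> \<iota> b \<Omega>) vs = (\<Sum>i<length vs. \<alpha> (vs ! i) * \<Omega> (vs[i := b]))"
  unfolding wedge_def
proof (rule sum.cong[OF refl])
  fix i assume "i \<in> {..<length vs}"
  then have i: "i < length vs" by simp
  have "\<Omega> (b # take i vs @ drop (Suc i) vs) = (- 1) ^ i * \<Omega> (vs[i := b])"
    using forms_move[OF assms, of i "take i vs @ drop (Suc i) vs" b] i
    by (simp add: upd_conv_take_nth_drop min_def)
  then show "(- 1) ^ i * \<alpha> (vs ! i) * \<iota> b \<Omega> (take i vs @ drop (Suc i) vs)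
      = \<alpha> (vs ! i) * \<Omega> (vs[i := b])"
    by (simp add: interior_def flip: power_add)
qed

lemma sum_list_apply: "sum_list fs x = (\<Sum>f\<leftarrow>fs. f x)"
  by (induction fs) simp_all

lemma bracket_sum_apply:
  fixes B :: "'v::real_vector \<Rightarrow> 'v \<Rightarrow> real"
  assumes B: "inner_product B" "0 < dim (UNIV :: 'v set)" and \<Omega>: "\<Omega> \<in> forms p"
    and lin: "\<forall>(\<alpha>, \<beta>)\<in>set ps. linear \<alpha> \<and> linear \<beta>"
  shows "(\<Sum>(\<alpha>, \<beta>)\<leftarrow>ps. \<alpha> \<odot> \<iota> (sharp B \<beta>) \<Omega> - \<beta> \<odot> \<iota> (sharp B \<alpha>) \<Omega>) vs =
    (\<Sum>i<length vs. \<Omega> (vs[i := sharp B (\<lambda>y. (\<Sum>(\<alpha>, \<beta>)\<leftarrow>ps. wedge_list [\<alpha>, \<beta>]) [vs ! i, y])]))"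
proof -
  have linB: "linear (\<lambda>x. B x y)" for y using B(1) by (simp add: inner_product_def bilinear_def)
  have lin\<Omega>: "linear (\<lambda>x. \<Omega> (vs[i := x]))" if "i < length vs" for i
    using forms_linear[OF \<Omega>] that by (simp add: upd_conv_take_nth_drop)
  define S where "S ps v = (\<Sum>(\<alpha>, \<beta>)\<leftarrow>ps. \<alpha> v *\<^sub>R sharp B \<beta> - \<beta> v *\<^sub>R sharp B \<alpha>)" for ps v
  have sharp: "sharp B (\<lambda>y. (\<Sum>(\<alpha>, \<beta>)\<leftarrow>ps. wedge_list [\<alpha>, \<beta>]) [v, y]) = S ps v" for v
  proof (rule sharp_unique[OF B(1)])
    show "B (S ps v) y = (\<Sum>(\<alpha>, \<beta>)\<leftarrow>ps. wedge_list [\<alpha>, \<beta>]) [v, y]" for y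
      using lin
    proof (induction ps)
      case Nil
      then show ?case using linear_0[OF linB] by (simp add: S_def)
    next
      case (Cons q ps)
      obtain \<alpha> \<beta> where q: "q = (\<alpha>, \<beta>)" by fastforce
      have "S (q # ps) v = (\<alpha> v *\<^sub>R sharp B \<beta> - \<beta> v *\<^sub>R sharp B \<alpha>) + S ps v"
        by (simp add: S_def q)
      then show ?case
        using Cons q
        by (simp add: linear_add[OF linB] linear_diff[OF linB] linear_cmul[OF linB]
            inner_sharp[OF B] wedge_list_two)
    qed
  qed
  have "(\<Sum>(\<alpha>, \<beta>)\<leftarrow>ps. \<alpha> \<odot> \<iota> (sharp B \<beta>) \<Omega> - \<beta> \<odot> \<iota> (sharp B \<alpha>) \<Omega>) vs =
      (\<Sum>i<length vs. \<Omega> (vs[i := S ps (vs ! i)]))"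
  proof (induction ps)
    case Nil
    then show ?case using linear_0[OF lin\<Omega>] by (simp add: S_def)
  next
    case (Cons q ps)
    obtain \<alpha> \<beta> where q: "q = (\<alpha>, \<beta>)" by fastforce
    have "\<Omega> (vs[i := S (q # ps) (vs ! i)]) =
        \<alpha> (vs ! i) * \<Omega> (vs[i := sharp B \<beta>]) - \<beta> (vs ! i) * \<Omega> (vs[i := sharp B \<alpha>])
        + \<Omega> (vs[i := S ps (vs ! i)])" if "i < length vs" for i
      by (simp add: S_def q linear_add[OF lin\<Omega>[OF that]] linear_diff[OF lin\<Omega>[OF that]]
          linear_cmul[OF lin\<Omega>[OF that]])
    then show ?case
      using Cons
      by (simp add: q wedge_interior_apply[OF \<Omega>] sum.distrib sum_subtractf)
  qed
  then show ?thesis by (simp add: sharp)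
qed

lemma bracket_sum_list:
  fixes B :: "'v::real_vector \<Rightarrow> 'v \<Rightarrow> real"
  assumes B: "inner_product B" "0 < dim (UNIV :: 'v set)" and \<Omega>: "\<Omega> \<in> forms p"
    and lin: "\<forall>(\<alpha>, \<beta>)\<in>set ps. linear \<alpha> \<and> linear \<beta>"
  shows "bracket B (\<Sum>(\<alpha>, \<beta>)\<leftarrow>ps. wedge_list [\<alpha>, \<beta>]) \<Omega> =
    (\<Sum>(\<alpha>, \<beta>)\<leftarrow>ps. \<alpha> \<odot> \<iota> (sharp B \<beta>) \<Omega> - \<beta> \<odot> \<iota> (sharp B \<alpha>) \<Omega>)"
  unfolding bracket_def
proof (rule the_equality, goal_cases)
  case 1
  show ?case using lin by blast
next
  case (2 \<Theta>)
  then obtain qs where qs: "\<forall>(\<alpha>, \<beta>)\<in>set qs. linear \<alpha> \<and> linear \<beta>"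
      "(\<Sum>(\<alpha>, \<beta>)\<leftarrow>ps. wedge_list [\<alpha>, \<beta>]) = (\<Sum>(\<alpha>, \<beta>)\<leftarrow>qs. wedge_list [\<alpha>, \<beta>])"
      "\<Theta> = (\<Sum>(\<alpha>, \<beta>)\<leftarrow>qs. \<alpha> \<odot> \<iota> (sharp B \<beta>) \<Omega> - \<beta> \<odot> \<iota> (sharp B \<alpha>) \<Omega>)"
    by blast
  show ?case
    unfolding fun_eq_iff qs(3)
      bracket_sum_apply[OF B \<Omega> lin] bracket_sum_apply[OF B \<Omega> qs(1)] qs(2)
    by simp
qed

lemma two_form_sum_list:
  fixes \<omega> :: "'v::real_vector form"
  assumes fin: "0 < dim (UNIV :: 'v set)" and \<omega>: "\<omega> \<in> forms 2"
  shows "\<exists>ps. (\<forall>(\<alpha>, \<beta>)\<in>set ps. linear \<alpha> \<and> linear \<beta>) \<and> \<omega> = (\<Sum>(\<alpha>, \<beta>)\<leftarrow>ps. wedge_list [\<alpha>, \<beta>])"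
proof -
  obtain b :: "'v set" where b: "independent b" "span b = UNIV" "card b = dim (UNIV :: 'v set)"
    using basis_exists[of "UNIV :: 'v set"] by (metis top.extremum_uniqueI)
  then have finb: "finite b" using fin card_gt_0_iff by metis
  obtain es where es: "set es = b" "distinct es" using finite_distinct_list[OF finb] by blast
  have lin1: "linear (\<lambda>x. \<omega> [x, v])" and lin2: "linear (\<lambda>x. \<omega> [v, x])" for v
    using forms_linear[OF \<omega>, of "[]" "[v]"] forms_linear[OF \<omega>, of "[v]" "[]"] by simp_all
  have anti: "\<omega> [u, v] = - \<omega> [v, u]" for u v
    using swap_adjacent[OF forms_linear[OF \<omega>] forms_adjacent[OF \<omega>], of "[]" u v "[]"] by simp
  define ps where "ps = map (\<lambda>e. (\<lambda>x. representation b x e, \<lambda>x. \<omega> [e, x] / 2)) es"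
  have lin: "\<forall>(\<alpha>, \<beta>)\<in>set ps. linear \<alpha> \<and> linear \<beta>"
  proof -
    have "linear (\<lambda>x. representation b x e)" for e
      using b by (intro linearI) (simp_all add: representation_add representation_scale)
    moreover have "linear (\<lambda>x. \<omega> [e, x] / 2)" for e
      by (rule linearI) (simp_all add: linear_add[OF lin2] linear_cmul[OF lin2] add_divide_distrib)
    ultimately show ?thesis by (auto simp: ps_def)
  qed
  have expand: "(\<Sum>e\<in>b. representation b u e * \<omega> [e, v]) = \<omega> [u, v]" for u v
  proof -
    have "\<omega> [(\<Sum>e\<in>b. representation b u e *\<^sub>R e), v] = (\<Sum>e\<in>b. representation b u e * \<omega> [e, v])"
      by (simp add: linear_sum[OF lin1] linear_cmul[OF lin1])
    moreover have "(\<Sum>e\<in>b. representation b u e *\<^sub>R e) = u"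
      using sum_representation_eq[of b u b] b finb by simp
    ultimately show ?thesis by simp
  qed
  have "\<omega> vs = (\<Sum>(\<alpha>, \<beta>)\<leftarrow>ps. wedge_list [\<alpha>, \<beta>]) vs" for vs
  proof (cases "length vs = 2")
    case True
    then obtain u v where vs: "vs = [u, v]"
      by (auto simp: numeral_2_eq_2 length_Suc_conv)
    have "(\<Sum>(\<alpha>, \<beta>)\<leftarrow>ps. wedge_list [\<alpha>, \<beta>]) vs =
        (\<Sum>e\<in>b. representation b u e * (\<omega> [e, v] / 2) - representation b v e * (\<omega> [e, u] / 2))"
      unfolding ps_def es(1)[symmetric]
      by (simp add: sum_list_apply comp_def vs wedge_list_two
          flip: sum_list_distinct_conv_sum_set[OF es(2)])
    also have "\<dots> = \<omega> [u, v] / 2 - \<omega> [v, u] / 2"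
      unfolding sum_subtractf times_divide_eq_right sum_divide_distrib[symmetric] expand ..
    also have "\<dots> = \<omega> vs" using anti[of u v] by (simp add: vs)
    finally show ?thesis by simp
  next
    case False
    have "wedge_list [\<alpha>, \<beta>] vs = 0" if "(\<alpha>, \<beta>) \<in> set ps" for \<alpha> \<beta>
      using lin that False forms_length[OF wedge_list_in_forms[of "[\<alpha>, \<beta>]"], of vs]
      by (auto simp: numeral_2_eq_2)
    then have "(\<Sum>(\<alpha>, \<beta>)\<leftarrow>qs. wedge_list [\<alpha>, \<beta>]) vs = 0" if "set qs \<subseteq> set ps" for qs
      using that by (induction qs) auto
    then show ?thesis using forms_length[OF \<omega> False] by simp
  qed
  then show ?thesis using lin by blast
qed

lemma bracket_apply:
  fixes B :: "'v::real_vector \<Rightarrow> 'v \<Rightarrow> real"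
  assumes B: "inner_product B" "0 < dim (UNIV :: 'v set)"
    and \<omega>: "\<omega> \<in> forms 2" and \<Omega>: "\<Omega> \<in> forms p"
  shows "bracket B \<omega> \<Omega> vs = (\<Sum>i<length vs. \<Omega> (vs[i := sharp B (\<lambda>y. \<omega> [vs ! i, y])]))"
proof -
  obtain ps where ps: "\<forall>(\<alpha>, \<beta>)\<in>set ps. linear \<alpha> \<and> linear \<beta>"
      "\<omega> = (\<Sum>(\<alpha>, \<beta>)\<leftarrow>ps. wedge_list [\<alpha>, \<beta>])"
    using two_form_sum_list[OF B(2) \<omega>] by blast
  show ?thesis
    unfolding ps(2) bracket_sum_list[OF B \<Omega> ps(1)] by (rule bracket_sum_apply[OF B \<Omega> ps(1)])
qed

end

theory Submission
  imports Defs
begin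

text \<open>
  Put \<open>[X, Y] = sharp (F [X, Y, -])\<close>. Then \<open>[\<iota> X F, F] = 0\<close> for all \<open>X\<close> is the Jacobi identity, so
  the data are a six-dimensional Lie algebra with an invariant inner product.

  Let \<open>e 0\<close> be a unit vector, timelike in the lorentzian case, so that its orthogonal complement \<open>E\<close>
  is euclidean of dimension five. The restriction of \<open>F\<close> to \<open>E\<close> is the Hodge dual of a bivector, that
  is, of a skew operator \<open>C\<close> of \<open>E\<close>, and the Jacobi identity for \<open>X = e 0\<close> says that \<open>C\<close> commutes with
  the skew operator \<open>A = [e 0, -]\<close> of \<open>E\<close>. A simultaneous normal form of \<open>A\<close> and \<open>C\<close> gives an
  orthonormal basis \<open>e 1, \<dots>, e 5\<close> of \<open>E\<close> for which \<open>F = e12 \<and> u + e34 \<and> v\<close> with \<open>u\<close> and \<open>v\<close> in the span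
  of \<open>e 0\<close> and \<open>e 5\<close>. The Jacobi identity for \<open>e 1, e 2, e 3, e 4\<close> then reads \<open>B u v = 0\<close>.

  Conversely, a simple form is the structure tensor of a Lie algebra, and the operators \<open>[X, -]\<close>
  defined by one of two orthogonal simple forms annihilate the other.
\<close>

section \<open>Three-forms and the Jacobi identity\<close>

lemma forms3_props:
  fixes F :: "'v::real_vector form"
  assumes F: "F \<in> forms 3"
  shows forms3_linear1: "linear (\<lambda>x. F [x, y, z])"
    and forms3_linear2: "linear (\<lambda>y. F [x, y, z])"
    and forms3_linear3: "linear (\<lambda>z. F [x, y, z])"
    and forms3_swap12: "F [y, x, z] = - F [x, y, z]"
    and forms3_swap23: "F [x, z, y] = - F [x, y, z]"
  using forms_linear[OF F, of "[]" "[y, z]"] forms_linear[OF F, of "[x]" "[z]"]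
    forms_linear[OF F, of "[x, y]" "[]"]
    swap_adjacent[OF forms_linear[OF F] forms_adjacent[OF F], of "[]" y x "[z]"]
    swap_adjacent[OF forms_linear[OF F] forms_adjacent[OF F], of "[x]" z y "[]"]
  by simp_all

lemma forms3_repeat:
  fixes F :: "'v::real_vector form"
  assumes "F \<in> forms 3"
  shows "F [x, x, y] = 0" "F [x, y, x] = 0" "F [y, x, x] = 0"
  using forms_not_distinct[OF assms] by simp_all

text \<open>As conditional rewrite rules, these sort the indices of the components \<open>F [e i, e j, e k]\<close>.\<close>

lemma forms3_sort:
  fixes F :: "'v::real_vector form" and e :: "nat \<Rightarrow> 'v"
  assumes "F \<in> forms 3" and "i < j"
  shows "F [e j, e i, z] = - F [e i, e j, z]" "F [z, e j, e i] = - F [z, e i, e j]"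
  using forms3_swap12[OF assms(1)] forms3_swap23[OF assms(1)] by blast+

lemma wedge_list_three:
  "wedge_list [\<alpha>, \<beta>, \<gamma>] [x, y, z] =
     \<alpha> x * (\<beta> y * \<gamma> z - \<gamma> y * \<beta> z) - \<beta> x * (\<alpha> y * \<gamma> z - \<gamma> y * \<alpha> z) + \<gamma> x * (\<alpha> y * \<beta> z - \<beta> y * \<alpha> z)"
  by (simp add: wedge_list_def wedge_Cons interior_def unit_form_def algebra_simps)

lemma forms_plus:
  assumes "\<omega> \<in> forms p" "\<eta> \<in> forms p"
  shows "\<omega> + \<eta> \<in> forms p"
  using assms by (auto simp: forms_def linear_compose_add)

lemma form3_eq_zero_iff:
  assumes "\<And>vs. length vs \<noteq> 3 \<Longrightarrow> \<omega> vs = 0"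
  shows "\<omega> = 0 \<longleftrightarrow> (\<forall>x y z. \<omega> [x, y, z] = (0 :: real))"
proof
  assume *: "\<forall>x y z. \<omega> [x, y, z] = 0"
  have "\<omega> vs = 0" for vs
  proof (cases "length vs = 3")
    case True
    then show ?thesis using * by (auto simp: numeral_3_eq_3 length_Suc_conv)
  qed (rule assms)
  then show "\<omega> = 0" by (simp add: fun_eq_iff)
qed simp

text \<open>By \<open>bracket_apply\<close> each argument in turn is replaced by its bracket with
  \<open>X\<close>, so the equation says that the derivation \<open>[X, -]\<close> annihilates
  \<open>F\<close>. Since \<open>F [x, y, z]\<close> is the inner product of \<open>[x, y]\<close>
  with \<open>z\<close> and \<open>[X, -]\<close> is skew, this is the Jacobi identity.\<close>

lemma bracket_interior_eq_zero_iff: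
  fixes B :: "'v::real_vector \<Rightarrow> 'v \<Rightarrow> real"
  assumes B: "inner_product B" "0 < dim (UNIV :: 'v set)" and F: "F \<in> forms 3"
  shows "bracket B (\<iota> X F) F = 0 \<longleftrightarrow>
    (\<forall>x y z. F [sharp B (\<lambda>v. F [X, x, v]), y, z] + F [x, sharp B (\<lambda>v. F [X, y, v]), z]
       + F [x, y, sharp B (\<lambda>v. F [X, z, v])] = 0)"
proof -
  have "\<iota> X F \<in> forms 2" using interior_in_forms[OF F, of X] by simp
  note ba = bracket_apply[OF B this F]
  have "bracket B (\<iota> X F) F vs = 0" if "length vs \<noteq> 3" for vs
    unfolding ba using that by (intro sum.neutral) (simp add: forms_length[OF F])
  moreover have "bracket B (\<iota> X F) F [x, y, z] = F [sharp B (\<lambda>v. F [X, x, v]), y, z]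
      + F [x, sharp B (\<lambda>v. F [X, y, v]), z] + F [x, y, sharp B (\<lambda>v. F [X, z, v])]" for x y z
    unfolding ba by (simp add: interior_def numeral_3_eq_3)
  ultimately show ?thesis using form3_eq_zero_iff[of "bracket B (\<iota> X F) F"] by simp
qed

section \<open>Orthogonal simple forms satisfy the Jacobi identity\<close>

lemma orthogonal_simple_formsE:
  fixes B :: "'v::real_vector \<Rightarrow> 'v \<Rightarrow> real"
  assumes B: "inner_product B" "0 < dim (UNIV :: 'v set)"
    and simple: "simple_form 3 F1" "simple_form 3 F2" and orth: "orthogonal_forms B F1 F2"
  obtains a1 a2 a3 b1 b2 b3 :: 'v where
    "F1 = wedge_list [B a1, B a2, B a3]" "F2 = wedge_list [B b1, B b2, B b3]"
    "\<And>a b. a \<in> {a1, a2, a3} \<Longrightarrow> b \<in> {b1, b2, b3} \<Longrightarrow> B a b = 0"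
proof -
  have lists: "\<exists>a1 a2 a3. G = wedge_list [B a1, B a2, B a3] \<and> (G \<noteq> 0 \<longrightarrow>
      {a1, a2, a3} \<subseteq> form_plane B G) \<and> (G = 0 \<longrightarrow> a1 = 0 \<and> a2 = 0 \<and> a3 = 0)"
    if "simple_form 3 G" for G :: "'v form"
  \<comment> \<open>The zero form has no well-defined plane and is orthogonal to everything by
    convention. Representing it by three zero vectors makes the factors orthogonal in this case
    too.\<close>
  proof (cases "G = 0")
    case True
    have "B 0 = (\<lambda>_. 0)" using bilinear_lzero[of B] B(1) by (metis inner_product_def)
    then have "wedge_list [B 0, B 0, B 0] = 0"
      by (simp add: wedge_list_def wedge_def fun_eq_iff)
    then show ?thesis using True by auto
  next
    case False
    obtain \<alpha>s where \<alpha>s: "length \<alpha>s = 3" "\<forall>\<alpha>\<in>set \<alpha>s. linear \<alpha>" "G = wedge_list \<alpha>s"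
      using \<open>simple_form 3 G\<close> by (auto simp: simple_form_def)
    then obtain \<alpha> \<beta> \<gamma> where l: "\<alpha>s = [\<alpha>, \<beta>, \<gamma>]" by (auto simp: numeral_3_eq_3 length_Suc_conv)
    have "B (sharp B \<delta>) = \<delta>" if "\<delta> \<in> set \<alpha>s" for \<delta>
      using inner_sharp[OF B] \<alpha>s(2) that by (simp add: fun_eq_iff)
    moreover have "form_plane B G = span (sharp B ` set \<alpha>s)"
      using form_plane_wedge_list[OF B \<alpha>s(2)] \<alpha>s(3) False by simp
    ultimately show ?thesis using False \<alpha>s(3) unfolding l
      by (intro exI[of _ "sharp B \<alpha>"] exI[of _ "sharp B \<beta>"] exI[of _ "sharp B \<gamma>"])
        (auto intro: span_base)
  qed
  obtain a1 a2 a3 where a: "F1 = wedge_list [B a1, B a2, B a3]"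
      "F1 \<noteq> 0 \<longrightarrow> {a1, a2, a3} \<subseteq> form_plane B F1" "F1 = 0 \<longrightarrow> a1 = 0 \<and> a2 = 0 \<and> a3 = 0"
    using lists[OF simple(1)] by blast
  obtain b1 b2 b3 where b: "F2 = wedge_list [B b1, B b2, B b3]"
      "F2 \<noteq> 0 \<longrightarrow> {b1, b2, b3} \<subseteq> form_plane B F2" "F2 = 0 \<longrightarrow> b1 = 0 \<and> b2 = 0 \<and> b3 = 0"
    using lists[OF simple(2)] by blast
  have bil: "bilinear B" using B(1) by (simp add: inner_product_def)
  have zero: "B 0 x = 0" "B x 0 = 0" for x
    by (simp_all add: bilinear_lzero[OF bil] bilinear_rzero[OF bil])
  have "B x y = 0" if xy: "x \<in> {a1, a2, a3}" "y \<in> {b1, b2, b3}" for x y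
  proof (cases "F1 = 0 \<or> F2 = 0")
    case True
    then show ?thesis using a(3) b(3) xy zero by auto
  next
    case False
    then have "x \<in> form_plane B F1" "y \<in> form_plane B F2" using a(2) b(2) xy by blast+
    then show ?thesis using orth False unfolding orthogonal_forms_def by blast
  qed
  then show thesis using a(1) b(1) by (intro that)
qed

text \<open>The Lie bracket of a simple form: the vector dual to
  \<open>wedge_list [B a1, B a2, B a3] [X, x, -]\<close>. Its values lie in the span of
  \<open>a1\<close>, \<open>a2\<close>, \<open>a3\<close>.\<close>

definition cross :: "('v \<Rightarrow> 'v \<Rightarrow> real) \<Rightarrow> 'v \<Rightarrow> 'v \<Rightarrow> 'v \<Rightarrow> 'v \<Rightarrow> 'v \<Rightarrow> 'v::real_vector" where
  "cross B a1 a2 a3 X x = (B a1 X * B a2 x - B a2 X * B a1 x) *\<^sub>R a3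
      + (B a2 X * B a3 x - B a3 X * B a2 x) *\<^sub>R a1 + (B a3 X * B a1 x - B a1 X * B a3 x) *\<^sub>R a2"

text \<open>Here \<open>N x\<close> is a sum of terms \<open>P k j * B (a j) x\<close> times
  \<open>a k\<close> with \<open>P\<close> antisymmetric. The derivation therefore multiplies
  \<open>w\<close> by the trace of \<open>P\<close> times the Gram matrix of the \<open>a k\<close>,
  which vanishes because that matrix is symmetric.\<close>

lemma cross_derivation:
  fixes B :: "'v::real_vector \<Rightarrow> 'v \<Rightarrow> real"
  assumes sym: "\<And>u v. B u v = B v u" and bil: "bilinear B"
    and w: "w = wedge_list [B a1, B a2, B a3]" and N: "N = cross B a1 a2 a3 X"
  shows "w [N x, y, z] + w [x, N y, z] + w [x, y, N z] = 0"
proof -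
  have B1: "B a1 (N x) = (B a1 X * B a2 x - B a2 X * B a1 x) * B a1 a3
      + (B a2 X * B a3 x - B a3 X * B a2 x) * B a1 a1 + (B a3 X * B a1 x - B a1 X * B a3 x) * B a1 a2" for x
    by (simp add: N cross_def bilinear_radd[OF bil] bilinear_rmul[OF bil])
  have B2: "B a2 (N x) = (B a1 X * B a2 x - B a2 X * B a1 x) * B a2 a3
      + (B a2 X * B a3 x - B a3 X * B a2 x) * B a1 a2 + (B a3 X * B a1 x - B a1 X * B a3 x) * B a2 a2" for x
    by (simp add: N cross_def bilinear_radd[OF bil] bilinear_rmul[OF bil] sym[of a2 a1])
  have B3: "B a3 (N x) = (B a1 X * B a2 x - B a2 X * B a1 x) * B a3 a3
      + (B a2 X * B a3 x - B a3 X * B a2 x) * B a1 a3 + (B a3 X * B a1 x - B a1 X * B a3 x) * B a2 a3" for x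
    by (simp add: N cross_def bilinear_radd[OF bil] bilinear_rmul[OF bil] sym[of a3 a1] sym[of a3 a2])
  show ?thesis
    unfolding w wedge_list_three B1 B2 B3 by algebra
qed

lemma bracket_orthogonal_simple_eq_zero:
  fixes B :: "'v::real_vector \<Rightarrow> 'v \<Rightarrow> real"
  assumes B: "inner_product B" "0 < dim (UNIV :: 'v set)"
    and F1: "F1 = wedge_list [B a1, B a2, B a3]" and F2: "F2 = wedge_list [B b1, B b2, B b3]"
    and orth: "\<And>a b. a \<in> {a1, a2, a3} \<Longrightarrow> b \<in> {b1, b2, b3} \<Longrightarrow> B a b = 0"
  shows "bracket B (\<iota> X (F1 + F2)) (F1 + F2) = 0"
proof -
  have sym: "\<And>u v. B u v = B v u" and bil: "bilinear B" using B(1) by (auto simp: inner_product_def)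
  have lin: "linear (B a)" for a using bil by (simp add: bilinear_def)
  have F: "F1 + F2 \<in> forms 3"
    using lin wedge_list_in_forms[of "[B a1, B a2, B a3]"] wedge_list_in_forms[of "[B b1, B b2, B b3]"]
    unfolding F1 F2 by (intro forms_plus) (simp_all add: numeral_3_eq_3)
  define N where "N a1 a2 a3 = cross B a1 a2 a3 X" for a1 a2 a3
  note BN = bilinear_ladd[OF bil] bilinear_lmul[OF bil] bilinear_radd[OF bil] bilinear_rmul[OF bil]
  have sharp: "sharp B (\<lambda>v. (F1 + F2) [X, x, v]) = N a1 a2 a3 x + N b1 b2 b3 x" for x
  proof (rule sharp_unique[OF B(1)])
    show "B (N a1 a2 a3 x + N b1 b2 b3 x) v = (F1 + F2) [X, x, v]" for v
      unfolding F1 F2 N_def cross_def BN plus_fun_apply wedge_list_three real_scaleR_def by algebra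
  qed
  \<comment> \<open>Each bracket takes values in the span of its own factors, on which the factors
    of the other form vanish. So the mixed terms drop out and \<open>cross_derivation\<close>
    applies to each form separately.\<close>
  have ab: "B a (N b1 b2 b3 x) = 0" if "a \<in> {a1, a2, a3}" for a x
    using orth[OF that] by (simp add: N_def cross_def BN)
  have ba: "B b (N a1 a2 a3 x) = 0" if "b \<in> {b1, b2, b3}" for b x
    using orth[OF _ that] by (simp add: N_def cross_def BN sym[of b])
  have F1N: "F1 [N a1 a2 a3 x + N b1 b2 b3 x, y, z] = F1 [N a1 a2 a3 x, y, z]"
      "F1 [x, N a1 a2 a3 y + N b1 b2 b3 y, z] = F1 [x, N a1 a2 a3 y, z]"
      "F1 [x, y, N a1 a2 a3 z + N b1 b2 b3 z] = F1 [x, y, N a1 a2 a3 z]" for x y z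
    by (simp_all add: F1 wedge_list_three bilinear_radd[OF bil] ab)
  have F2N: "F2 [N a1 a2 a3 x + N b1 b2 b3 x, y, z] = F2 [N b1 b2 b3 x, y, z]"
      "F2 [x, N a1 a2 a3 y + N b1 b2 b3 y, z] = F2 [x, N b1 b2 b3 y, z]"
      "F2 [x, y, N a1 a2 a3 z + N b1 b2 b3 z] = F2 [x, y, N b1 b2 b3 z]" for x y z
    by (simp_all add: F2 wedge_list_three bilinear_radd[OF bil] ba)
  show ?thesis
    unfolding bracket_interior_eq_zero_iff[OF B F] sharp
    using cross_derivation[OF sym bil F1 N_def] cross_derivation[OF sym bil F2 N_def]
    by (simp add: F1N F2N algebra_simps)
qed


section \<open>Commuting skew operators on a euclidean space\<close>

text \<open>A maximizer of the Rayleigh quotient on the unit sphere of \<open>W\<close> is an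
  eigenvector. Stating this for invariant subspaces allows repeated use inside eigenspaces.\<close>

lemma symmetric_eigenvector:
  fixes S :: "'a::euclidean_space \<Rightarrow> 'a"
  assumes S: "linear S" and sym: "\<And>x y. S x \<bullet> y = x \<bullet> S y"
    and W: "subspace W" "\<not> W \<subseteq> {0}" and inv: "\<And>x. x \<in> W \<Longrightarrow> S x \<in> W"
  shows "\<exists>x\<in>W. norm x = 1 \<and> (\<exists>c. S x = c *\<^sub>R x)"
proof -
  let ?K = "sphere 0 1 \<inter> W"
  obtain w where w: "w \<in> W" "w \<noteq> 0" using W(2) by blast
  have "(1 / norm w) *\<^sub>R w \<in> ?K" using w subspace_scale[OF W(1)] by simp
  then have "?K \<noteq> {}" by blast
  moreover have "compact ?K" using closed_subspace[OF W(1)] by (intro compact_Int_closed) auto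
  moreover have "continuous_on ?K (\<lambda>x. S x \<bullet> x)"
    using linear_continuous_on[of S] S by (intro continuous_intros) (simp add: linear_conv_bounded_linear)
  ultimately obtain x where x: "x \<in> ?K" and max: "\<And>y. y \<in> ?K \<Longrightarrow> S y \<bullet> y \<le> S x \<bullet> x"
    using continuous_attains_sup[of ?K "\<lambda>x. S x \<bullet> x"] by blast
  define c where "c = S x \<bullet> x"
  have xx: "x \<bullet> x = 1" using x by (simp add: norm_eq_1)
  have q: "0 \<le> c * (y \<bullet> y) - S y \<bullet> y" if "y \<in> W" for y
  proof (cases "y = 0")
    case True
    then show ?thesis by simp
  next
    case False
    have "(1 / norm y) *\<^sub>R y \<in> ?K" using False that subspace_scale[OF W(1)] by simp
    then have "(S y \<bullet> y) / (y \<bullet> y) \<le> c"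
      using max[of "(1 / norm y) *\<^sub>R y"]
      by (simp add: c_def linear_cmul[OF S] power2_norm_eq_inner[symmetric] power2_eq_square)
    moreover have "0 < y \<bullet> y" using False by simp
    ultimately show ?thesis by (simp add: pos_divide_le_eq)
  qed
  \<comment> \<open>The form \<open>c * (z \<bullet> z) - S z \<bullet> z\<close> is nonnegative on
    \<open>W\<close> and vanishes at \<open>x\<close>. At \<open>x + t *\<^sub>R y\<close> it equals
    \<open>2 * t * m + t\<^sup>2 * r\<close>, so its linear coefficient, the squared length of the
    defect \<open>y\<close>, has to be zero.\<close>
  define y where "y = c *\<^sub>R x - S x"
  define m where "m = y \<bullet> y"
  define r where "r = c * (y \<bullet> y) - S y \<bullet> y"
  have yW: "y \<in> W" unfolding y_def
    using x inv by (intro subspace_diff[OF W(1)] subspace_scale[OF W(1)]) auto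
  have m: "c * (x \<bullet> y) - S x \<bullet> y = m" by (simp add: m_def y_def inner_diff_left)
  have "0 \<le> 2 * t * m + t\<^sup>2 * r" for t
  proof -
    have "x + t *\<^sub>R y \<in> W" using x yW by (intro subspace_add[OF W(1)] subspace_scale[OF W(1)]) auto
    moreover have "S y \<bullet> x = S x \<bullet> y" by (metis sym inner_commute)
    then have "c * ((x + t *\<^sub>R y) \<bullet> (x + t *\<^sub>R y)) - S (x + t *\<^sub>R y) \<bullet> (x + t *\<^sub>R y)
        = (c * (x \<bullet> x) - S x \<bullet> x) + 2 * t * (c * (x \<bullet> y) - S x \<bullet> y) + t\<^sup>2 * r"
      by (simp add: linear_add[OF S] linear_cmul[OF S] inner_add_left inner_add_right r_def
          power2_eq_square inner_commute[of y x]) (simp add: algebra_simps)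
    ultimately show ?thesis using q unfolding m c_def[symmetric] xx by fastforce
  qed
  note 1 = this
  have r: "0 \<le> r" using q[OF yW] by (simp add: r_def)
  \<comment> \<open>At \<open>t = - k\<close> the quadratic is
    \<open>- (k\<^sup>2 * (r + 2))\<close>; the denominator \<open>r + 1\<close> is positive even
    when \<open>r = 0\<close>.\<close>
  define k where "k = m / (r + 1)"
  have mk: "m = k * (r + 1)" using r by (simp add: k_def)
  have "k\<^sup>2 * (r + 2) \<le> 0"
    using 1[of "- k"] unfolding mk by (simp add: power2_eq_square algebra_simps)
  then have "k = 0" using r by (simp add: mult_le_0_iff)
  then have "m = 0" by (simp add: mk)
  then have "S x = c *\<^sub>R x" by (simp add: m_def y_def)
  then show ?thesis using x by auto
qed

section \<open>Simultaneous normal form of two commuting skew operators\<close>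

locale commuting_skew =
  fixes A C :: "'a::euclidean_space \<Rightarrow> 'a"
  assumes linA: "linear A" and linC: "linear C"
    and skewA: "\<And>x y. A x \<bullet> y = - (x \<bullet> A y)" and skewC: "\<And>x y. C x \<bullet> y = - (x \<bullet> C y)"
    and comm: "\<And>x. A (C x) = C (A x)"
begin

definition invariant :: "'a set \<Rightarrow> bool" where
  "invariant W \<longleftrightarrow> subspace W \<and> (\<forall>x\<in>W. A x \<in> W \<and> C x \<in> W)"

text \<open>Both operators act on the plane of \<open>x\<close> and \<open>y\<close> as multiples of
  one quarter turn. The multiples may be zero, so two orthonormal vectors in the common kernel also
  form a block.\<close>

definition block :: "'a \<Rightarrow> 'a \<Rightarrow> bool" where
  "block x y \<longleftrightarrow> norm x = 1 \<and> norm y = 1 \<and> x \<bullet> y = 0 \<and>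
     (\<exists>a c. A x = a *\<^sub>R y \<and> A y = - a *\<^sub>R x \<and> C x = c *\<^sub>R y \<and> C y = - c *\<^sub>R x)"

text \<open>Skewness moves the operators to the other side of the inner product, so complements of
  invariant subspaces are invariant and summands can be split off one after another.\<close>

lemma invariant_Int_orthogonal:
  assumes W: "invariant W" and U: "invariant U"
  shows "invariant {w \<in> W. \<forall>x\<in>U. orthogonal x w}"
proof -
  have "subspace {w \<in> W. \<forall>x\<in>U. orthogonal x w}"
    using W unfolding invariant_def subspace_def by (auto simp: orthogonal_def inner_add_right)
  moreover have "x \<bullet> A w = - (A x \<bullet> w)" "x \<bullet> C w = - (C x \<bullet> w)" for x w
    using skewA skewC by simp_all
  ultimately show ?thesis using W U by (auto simp: invariant_def orthogonal_def)
qed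

lemma dim_Int_orthogonal:
  assumes "invariant W" "invariant U" "U \<subseteq> W"
  shows "dim {w \<in> W. \<forall>x\<in>U. orthogonal x w} + dim U = dim W"
  using assms dim_subspace_orthogonal_to_vectors[of U W] by (simp add: invariant_def)

lemma block_invariant:
  assumes "block x y" shows "invariant (span {x, y})"
proof -
  obtain a c where ac: "A x = a *\<^sub>R y" "A y = - a *\<^sub>R x" "C x = c *\<^sub>R y" "C y = - c *\<^sub>R x"
    using assms by (auto simp: block_def)
  have 1: "A z \<in> span {x, y}" if "z \<in> span {x, y}" for z
    using linear_span_image[OF linA, of "{x, y}"] that ac span_minimal[of "A ` {x, y}" "span {x, y}"]
    by (auto intro: span_scale span_neg span_base)
  have 2: "C z \<in> span {x, y}" if "z \<in> span {x, y}" for z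
    using linear_span_image[OF linC, of "{x, y}"] that ac span_minimal[of "C ` {x, y}" "span {x, y}"]
    by (auto intro: span_scale span_neg span_base)
  show ?thesis using 1 2 by (simp add: invariant_def)
qed

lemma block_dim:
  assumes "block x y" shows "dim (span {x, y}) = 2"
proof -
  have "x \<noteq> y" using assms by (auto simp: block_def)
  moreover have "independent {x, y}"
    using assms by (intro pairwise_orthogonal_independent) (auto simp: block_def pairwise_def orthogonal_def
        inner_commute)
  ultimately show ?thesis by (simp add: dim_eq_card_independent)
qed

text \<open>The squares of \<open>A\<close> and \<open>C\<close> and the product
  \<open>A \<circ> C\<close> are symmetric and commute, so three nested eigenspaces give a common
  unit eigenvector \<open>x\<close>. Outside the common kernel, \<open>x\<close> together with the
  normalized \<open>A x\<close> or \<open>C x\<close> is a block.\<close>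

lemma invariant_eigenvector_or_block:
  assumes W: "invariant W" "0 < dim W"
  shows "(\<exists>x\<in>W. norm x = 1 \<and> A x = 0 \<and> C x = 0) \<or> (\<exists>x\<in>W. \<exists>y\<in>W. block x y)"
proof -
  note lin = linear_add[OF linA] linear_cmul[OF linA] linear_0[OF linA]
    linear_add[OF linC] linear_cmul[OF linC] linear_0[OF linC]
  have eig: "\<exists>x\<in>U. norm x = 1 \<and> (\<exists>c. S (S x) = c *\<^sub>R x)"
    if "linear S" "\<And>x y. S x \<bullet> y = - (x \<bullet> S y)" "subspace U" "\<not> U \<subseteq> {0}" "\<And>x. x \<in> U \<Longrightarrow> S x \<in> U"
    for S :: "'a \<Rightarrow> 'a" and U
    using that symmetric_eigenvector[of "S \<circ> S" U] by (simp add: linear_compose)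
  have W0: "\<not> W \<subseteq> {0}" using W(2) by (metis dim_subset dim_singleton bot_nat_0.not_eq_extremum leD dim_eq_0)
  obtain x1 p where x1: "x1 \<in> W" "norm x1 = 1" "A (A x1) = p *\<^sub>R x1"
    using eig[OF linA skewA, of W] W W0 by (auto simp: invariant_def)
  let ?U = "{x \<in> W. A (A x) = p *\<^sub>R x}"
  have U: "subspace ?U" using W by (auto simp: subspace_def invariant_def lin scaleR_add_right)
  have "\<not> ?U \<subseteq> {0}" using x1 by auto
  then obtain x2 q where x2: "x2 \<in> ?U" "norm x2 = 1" "C (C x2) = q *\<^sub>R x2"
    using eig[OF linC skewC U] W by (auto simp: invariant_def comm lin)
  let ?U2 = "{x \<in> ?U. C (C x) = q *\<^sub>R x}"
  have U2: "subspace ?U2"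
    using U by (auto simp: subspace_def lin scaleR_add_right)
  have "\<not> ?U2 \<subseteq> {0}" using x2 by auto
  moreover have "linear (A \<circ> C)" using linA linC by (rule linear_compose[rotated])
  moreover have "(A \<circ> C) x \<bullet> y = x \<bullet> (A \<circ> C) y" for x y by (simp add: skewA skewC comm)
  moreover have "(A \<circ> C) x \<in> ?U2" if "x \<in> ?U2" for x
  proof -
    have "A (A (A (C x))) = p *\<^sub>R A (C x)" using that by (simp add: comm lin)
    moreover have "C (C (A (C x))) = q *\<^sub>R A (C x)" using that by (simp add: comm[symmetric] lin)
    ultimately show ?thesis using that W by (simp add: invariant_def)
  qed
  ultimately obtain x s where x: "x \<in> ?U2" "norm x = 1" "A (C x) = s *\<^sub>R x"
    using symmetric_eigenvector[OF _ _ U2, of "A \<circ> C"] by auto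
  have xx: "x \<bullet> x = 1" using x(2) by (simp add: norm_eq_1)
  have AA: "A (A x) = p *\<^sub>R x" and CC: "C (C x) = q *\<^sub>R x" and xW: "x \<in> W" using x by auto
  have AxAx: "A x \<bullet> A x = - p" using skewA[of x "A x"] AA xx by simp
  have CxCx: "C x \<bullet> C x = - q" using skewC[of x "C x"] CC xx by simp
  have xA: "x \<bullet> A x = 0" using skewA[of x x] by (simp add: inner_commute)
  have xC: "x \<bullet> C x = 0" using skewC[of x x] by (simp add: inner_commute)
  consider "A x = 0" "C x = 0" | "A x \<noteq> 0" | "A x = 0" "C x \<noteq> 0" by blast
  then show ?thesis
  proof cases
    case 1
    then show ?thesis using x xW by blast
  next
    case 2
    define a where "a = norm (A x)"
    have a: "a \<noteq> 0" "a * a = - p" using 2 AxAx by (simp_all add: a_def flip: power2_eq_square power2_norm_eq_inner)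
    define y where "y = (1 / a) *\<^sub>R A x"
    \<comment> \<open>Applying \<open>A\<close> to \<open>A (C x) = s *\<^sub>R x\<close> shows that
      \<open>C x\<close> is a multiple of \<open>A x\<close>, since \<open>p\<close> is nonzero.
      Hence the same \<open>y\<close> serves both operators.\<close>
    have "A (A (C x)) = s *\<^sub>R A x" using x(3) by (simp add: lin)
    then have "p *\<^sub>R C x = s *\<^sub>R A x" by (simp add: comm AA lin)
    moreover have p: "p \<noteq> 0" "p / a = - a" using a by (auto simp: field_simps)
    ultimately have "C x = (1 / p) *\<^sub>R (s *\<^sub>R A x)" by (metis divide_self scaleR_one scaleR_scaleR
        times_divide_eq_left mult_1)
    then have Cx: "C x = (- s / a) *\<^sub>R y" using a by (simp add: y_def)
    have "block x y" unfolding block_def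
    proof (intro conjI exI)
      show "norm y = 1" using 2 by (simp add: y_def a_def)
      show "x \<bullet> y = 0" using xA by (simp add: y_def)
      show "A x = a *\<^sub>R y" using a by (simp add: y_def)
      show "A y = - a *\<^sub>R x" using p(2) AA by (simp add: y_def lin)
      show "C x = (- s / a) *\<^sub>R y" by (rule Cx)
      show "C y = - (- s / a) *\<^sub>R x" using x(3) by (simp add: y_def lin comm[symmetric])
    qed fact
    moreover have "y \<in> W" using xW W by (auto simp: y_def invariant_def intro: subspace_scale)
    ultimately show ?thesis using xW by blast
  next
    case 3
    define a where "a = norm (C x)"
    have a: "a \<noteq> 0" "a * a = - q" using 3 CxCx by (simp_all add: a_def flip: power2_eq_square power2_norm_eq_inner)
    have q: "q / a = - a" using a by (auto simp: field_simps)
    define y where "y = (1 / a) *\<^sub>R C x"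
    have "block x y" unfolding block_def
    proof (intro conjI exI)
      show "norm y = 1" using 3 by (simp add: y_def a_def)
      show "x \<bullet> y = 0" using xC by (simp add: y_def)
      show "C x = a *\<^sub>R y" using a by (simp add: y_def)
      show "C y = - a *\<^sub>R x" using q CC by (simp add: y_def lin)
      show "A x = 0 *\<^sub>R y" using 3 by simp
      show "A y = - 0 *\<^sub>R x" using 3 by (simp add: y_def lin comm)
    qed fact
    moreover have "y \<in> W" using xW W by (auto simp: y_def invariant_def intro: subspace_scale)
    ultimately show ?thesis using xW by blast
  qed
qed

lemma invariant_Int_block_orthogonal:
  assumes "invariant W" "x \<in> W" "y \<in> W" "block x y"
  shows "\<exists>W'\<subseteq>W. invariant W' \<and> dim W' + 2 = dim W \<and> (\<forall>w\<in>W'. x \<bullet> w = 0 \<and> y \<bullet> w = 0)"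
proof -
  have "span {x, y} \<subseteq> W" using assms by (intro span_minimal) (auto simp: invariant_def)
  then show ?thesis
    using invariant_Int_orthogonal[OF assms(1) block_invariant[OF assms(4)]] block_dim[OF assms(4)]
      dim_Int_orthogonal[OF assms(1) block_invariant[OF assms(4)]]
    by (intro exI[of _ "{w \<in> W. \<forall>z\<in>span {x, y}. orthogonal z w}"])
       (auto simp: orthogonal_def intro: span_base)
qed

lemma invariant_Int_kernel_orthogonal:
  assumes "invariant W" "x \<in> W" "norm x = 1" "A x = 0" "C x = 0"
  shows "\<exists>W'\<subseteq>W. invariant W' \<and> dim W' + 1 = dim W \<and> (\<forall>w\<in>W'. x \<bullet> w = 0)"
proof -
  have "span {x} \<subseteq> W" using assms by (intro span_minimal) (auto simp: invariant_def)
  moreover have "A y = 0" "C y = 0" if "y \<in> span {x}" for y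
    using that assms(4,5)
    by (auto simp: span_singleton linear_cmul[OF linA] linear_cmul[OF linC])
  then have inv: "invariant (span {x})" by (simp add: invariant_def span_zero)
  moreover have "x \<noteq> 0" using assms(3) by auto
  then have "dim (span {x}) = 1" by (simp add: dim_eq_card_independent)
  ultimately show ?thesis
    using invariant_Int_orthogonal[OF assms(1) inv] dim_Int_orthogonal[OF assms(1) inv]
    by (intro exI[of _ "{w \<in> W. \<forall>z\<in>span {x}. orthogonal z w}"])
       (auto simp: orthogonal_def intro: span_base)
qed

text \<open>Splitting off a block keeps the dimension odd and lowers it. The descent ends at a
  subspace without blocks, where only a common kernel vector is possible.\<close>

lemma odd_dim_kernel:
  assumes "invariant W" "odd (dim W)"
  shows "\<exists>x\<in>W. norm x = 1 \<and> A x = 0 \<and> C x = 0"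
  using assms
proof (induction "dim W" arbitrary: W rule: less_induct)
  case less
  show ?case
  proof (cases "\<exists>x\<in>W. \<exists>y\<in>W. block x y")
    case True
    then obtain W' where "W' \<subseteq> W" "invariant W'" "dim W' + 2 = dim W"
      using invariant_Int_block_orthogonal[OF less.prems(1)] by metis
    then show ?thesis using less.hyps[of W'] less.prems(2) by (metis even_add even_numeral
        less_add_same_cancel1 subsetD zero_less_numeral)
  next
    case False
    then show ?thesis using invariant_eigenvector_or_block[OF less.prems(1)] less.prems(2) odd_pos[OF
        less.prems(2)] by blast
  qed
qed

text \<open>Without blocks there is a common kernel vector, and its complement, of odd dimension,
  contains a second one. These two form a block with zero multiples.\<close>

lemma even_dim_block:
  assumes W: "invariant W" "even (dim W)" "0 < dim W"
  shows "\<exists>x\<in>W. \<exists>y\<in>W. block x y"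
proof (rule ccontr)
  assume no: "\<not> ?thesis"
  then obtain x where x: "x \<in> W" "norm x = 1" "A x = 0" "C x = 0"
    using invariant_eigenvector_or_block[OF W(1,3)] by blast
  then obtain W' where W': "W' \<subseteq> W" "invariant W'" "dim W' + 1 = dim W" "\<forall>w\<in>W'. x \<bullet> w = 0"
    using invariant_Int_kernel_orthogonal[OF W(1)] by metis
  then obtain y where "y \<in> W'" "norm y = 1" "A y = 0" "C y = 0"
    using odd_dim_kernel[of W'] W(2) by (metis even_plus_one_iff)
  then have "block x y" using x W'(4) by (auto simp: block_def intro: exI[of _ 0])
  then show False using no x(1) W'(1) \<open>y \<in> W'\<close> by blast
qed

lemma normal_form:
  assumes "DIM('a) = 5"
  shows "\<exists>f1 f2 f3 f4 f5. block f1 f2 \<and> block f3 f4 \<and> norm f5 = 1 \<and> A f5 = 0 \<and> C f5 = 0 \<and>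
     (\<forall>x\<in>{f1, f2}. \<forall>y\<in>{f3, f4}. x \<bullet> y = 0) \<and> (\<forall>x\<in>{f1, f2, f3, f4}. x \<bullet> f5 = 0)"
proof -
  have U: "invariant UNIV" by (simp add: invariant_def)
  moreover have "odd (dim (UNIV :: 'a set))" using assms by simp
  ultimately obtain f5 where f5: "norm f5 = 1" "A f5 = 0" "C f5 = 0" using odd_dim_kernel by blast
  then obtain W where W: "invariant W" "dim W + 1 = dim (UNIV :: 'a set)" "\<forall>w\<in>W. f5 \<bullet> w = 0"
    using invariant_Int_kernel_orthogonal[OF U, of f5] by auto
  then have "dim W = 4" using assms by simp
  then obtain f1 f2 where f12: "f1 \<in> W" "f2 \<in> W" "block f1 f2" using even_dim_block[OF W(1)] by auto
  then obtain W' where W': "W' \<subseteq> W" "invariant W'" "dim W' + 2 = dim W" "\<forall>w\<in>W'. f1 \<bullet> w = 0 \<and> f2 \<bullet> w = 0"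
    using invariant_Int_block_orthogonal[OF W(1)] by metis
  then obtain f3 f4 where "f3 \<in> W'" "f4 \<in> W'" "block f3 f4"
    using even_dim_block[OF W'(2)] \<open>dim W = 4\<close> by auto
  then have "\<forall>x\<in>{f1, f2}. \<forall>y\<in>{f3, f4}. x \<bullet> y = 0" using W'(4) by blast
  moreover have "\<forall>x\<in>{f1, f2, f3, f4}. x \<bullet> f5 = 0"
    using f12 \<open>f3 \<in> W'\<close> \<open>f4 \<in> W'\<close> W'(1) W(3) inner_commute[of f5] by (metis insertE singletonD subsetD)
  ultimately show ?thesis using f5 f12(3) \<open>block f3 f4\<close> by blast
qed

text \<open>As bivectors, \<open>A\<close> and \<open>C\<close> are combinations of the same
  \<open>f1 \<and> f2\<close> and \<open>f3 \<and> f4\<close>. This common pair of planes is what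
  makes \<open>F\<close> split.\<close>

lemma orthonormal_normal_form:
  assumes dim: "DIM('a) = 5"
  obtains f1 f2 f3 f4 f5 a b c d where
    "f1 \<bullet> f1 = 1" "f2 \<bullet> f2 = 1" "f3 \<bullet> f3 = 1" "f4 \<bullet> f4 = 1" "f5 \<bullet> f5 = 1"
    "f1 \<bullet> f2 = 0" "f1 \<bullet> f3 = 0" "f1 \<bullet> f4 = 0" "f1 \<bullet> f5 = 0" "f2 \<bullet> f3 = 0"
    "f2 \<bullet> f4 = 0" "f2 \<bullet> f5 = 0" "f3 \<bullet> f4 = 0" "f3 \<bullet> f5 = 0" "f4 \<bullet> f5 = 0"
    "\<And>x. A x = a *\<^sub>R ((f1 \<bullet> x) *\<^sub>R f2 - (f2 \<bullet> x) *\<^sub>R f1) + b *\<^sub>R ((f3 \<bullet> x) *\<^sub>R f4 - (f4 \<bullet> x) *\<^sub>R f3)"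
    "\<And>x. C x = c *\<^sub>R ((f1 \<bullet> x) *\<^sub>R f2 - (f2 \<bullet> x) *\<^sub>R f1) + d *\<^sub>R ((f3 \<bullet> x) *\<^sub>R f4 - (f4 \<bullet> x) *\<^sub>R f3)"
proof -
  obtain f1 f2 f3 f4 f5 where f: "block f1 f2" "block f3 f4" "norm f5 = 1" "A f5 = 0" "C f5 = 0"
      "\<forall>x\<in>{f1, f2}. \<forall>y\<in>{f3, f4}. x \<bullet> y = 0" "\<forall>x\<in>{f1, f2, f3, f4}. x \<bullet> f5 = 0"
    using normal_form[OF dim] by blast
  obtain a c where 12: "A f1 = a *\<^sub>R f2" "A f2 = - a *\<^sub>R f1" "C f1 = c *\<^sub>R f2" "C f2 = - c *\<^sub>R f1"
    using f(1) unfolding block_def by blast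
  obtain b d where 34: "A f3 = b *\<^sub>R f4" "A f4 = - b *\<^sub>R f3" "C f3 = d *\<^sub>R f4" "C f4 = - d *\<^sub>R f3"
    using f(2) unfolding block_def by blast
  have on: "f1 \<bullet> f1 = 1" "f2 \<bullet> f2 = 1" "f3 \<bullet> f3 = 1" "f4 \<bullet> f4 = 1" "f5 \<bullet> f5 = 1"
    "f1 \<bullet> f2 = 0" "f1 \<bullet> f3 = 0" "f1 \<bullet> f4 = 0" "f1 \<bullet> f5 = 0" "f2 \<bullet> f3 = 0"
    "f2 \<bullet> f4 = 0" "f2 \<bullet> f5 = 0" "f3 \<bullet> f4 = 0" "f3 \<bullet> f5 = 0" "f4 \<bullet> f5 = 0"
    using f by (auto simp: block_def norm_eq_1)
  have on': "f2 \<bullet> f1 = 0" "f3 \<bullet> f1 = 0" "f4 \<bullet> f1 = 0" "f5 \<bullet> f1 = 0" "f3 \<bullet> f2 = 0"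
    "f4 \<bullet> f2 = 0" "f5 \<bullet> f2 = 0" "f4 \<bullet> f3 = 0" "f5 \<bullet> f3 = 0" "f5 \<bullet> f4 = 0"
    using on by (simp_all add: inner_commute)
  let ?S = "{f1, f2, f3, f4, f5}"
  have dist: "distinct [f1, f2, f3, f4, f5]" using on by auto
  then have card: "card ?S = 5" using distinct_card[of "[f1, f2, f3, f4, f5]"] by simp
  have "0 \<notin> ?S" using on by auto
  moreover have "pairwise orthogonal ?S" using on on' by (auto simp: pairwise_def orthogonal_def)
  ultimately have "independent ?S" by (intro pairwise_orthogonal_independent)
  then have span: "UNIV \<subseteq> span ?S" using card dim by (intro card_ge_dim_independent) auto
  have eq: "f x = g x" if "linear f" "linear g" "\<And>x. x \<in> ?S \<Longrightarrow> f x = g x" for f g :: "'a \<Rightarrow> 'a" and x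
    using linear_eq_on_span[OF that(1,2), of ?S x] that(3) span by blast
  have lin: "linear (\<lambda>x. p *\<^sub>R ((f1 \<bullet> x) *\<^sub>R f2 - (f2 \<bullet> x) *\<^sub>R f1) + q *\<^sub>R ((f3 \<bullet> x) *\<^sub>R f4 - (f4 \<bullet> x) *\<^sub>R f3))"
    for p q by (rule linearI) (simp_all add: inner_add_right algebra_simps)
  show thesis
    by (rule that[OF on, where a=a and b=b and c=c and d=d]; rule eq[OF _ lin])
       (use linA linC 12 34 f(4,5) in \<open>auto simp: on on'\<close>)
qed

end


section \<open>Three-forms in five dimensions\<close>

text \<open>A concrete model of the euclidean complement of \<open>e 0\<close>: unlike
  \<open>'v\<close>, it carries the \<open>euclidean_space\<close> structure on which the
  eigenvector argument rests.\<close>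

type_synonym real5 = "real \<times> real \<times> real \<times> real \<times> real"

text \<open>For \<open>i < j\<close>, \<open>pij\<close> is the \<open>j\<close>-th coordinate of
  the image of the \<open>i\<close>-th basis vector, so the parameters are the components of the
  corresponding two-form.\<close>

fun skew5 :: "real \<Rightarrow> real \<Rightarrow> real \<Rightarrow> real \<Rightarrow> real \<Rightarrow> real \<Rightarrow> real \<Rightarrow> real \<Rightarrow> real \<Rightarrow> real \<Rightarrow> real5 \<Rightarrow> real5" where
  "skew5 p12 p13 p14 p15 p23 p24 p25 p34 p35 p45 (x1, x2, x3, x4, x5) =
     (- p12 * x2 - p13 * x3 - p14 * x4 - p15 * x5,
      p12 * x1 - p23 * x3 - p24 * x4 - p25 * x5,
      p13 * x1 + p23 * x2 - p34 * x4 - p35 * x5,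
      p14 * x1 + p24 * x2 + p34 * x3 - p45 * x5,
      p15 * x1 + p25 * x2 + p35 * x3 + p45 * x4)"

lemma linear_skew5: "linear (skew5 p12 p13 p14 p15 p23 p24 p25 p34 p35 p45)"
  by (rule linearI) (auto simp: algebra_simps)

lemma skew5_skew:
  "skew5 p12 p13 p14 p15 p23 p24 p25 p34 p35 p45 x \<bullet> y =
     - (x \<bullet> skew5 p12 p13 p14 p15 p23 p24 p25 p34 p35 p45 y)"
  by (cases x, cases y) (simp add: algebra_simps)

text \<open>The determinant, written as a wedge product so that its alternation is inherited from
  \<open>forms\<close>.\<close>

definition vol5 :: "real5 \<Rightarrow> real5 \<Rightarrow> real5 \<Rightarrow> real5 \<Rightarrow> real5 \<Rightarrow> real" where
  "vol5 x y z u v = wedge_list [\<lambda>(x1, x2, x3, x4, x5). x1, \<lambda>(x1, x2, x3, x4, x5). x2,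
     \<lambda>(x1, x2, x3, x4, x5). x3, \<lambda>(x1, x2, x3, x4, x5). x4, \<lambda>(x1, x2, x3, x4, x5). x5] [x, y, z, u, v]"

lemma vol5_not_distinct: "\<not> distinct [x, y, z, u, v] \<Longrightarrow> vol5 x y z u v = 0"
  unfolding vol5_def
  by (rule forms_not_distinct[OF wedge_list_in_forms]) (auto intro!: linearI simp: algebra_simps)

abbreviation minor :: "real \<Rightarrow> real \<Rightarrow> real \<Rightarrow> real \<Rightarrow> real \<Rightarrow> real \<Rightarrow> real \<Rightarrow> real \<Rightarrow> real \<Rightarrow> real" where
  "minor x1 x2 x3 y1 y2 y3 z1 z2 z3 \<equiv>
     x1 * (y2 * z3 - y3 * z2) - x2 * (y1 * z3 - y3 * z1) + x3 * (y1 * z2 - y2 * z1)"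

text \<open>Laplace expansion along the first two vectors. Contracting a bivector with the volume
  form thus gives coefficients of the same ten minors as in \<open>forms3_expand5\<close>.\<close>

lemma vol5_expand:
  "vol5 (p1, p2, p3, p4, p5) (q1, q2, q3, q4, q5) (x1, x2, x3, x4, x5) (y1, y2, y3, y4, y5) (z1, z2, z3, z4, z5) =
     (p4 * q5 - p5 * q4) * minor x1 x2 x3 y1 y2 y3 z1 z2 z3
   - (p3 * q5 - p5 * q3) * minor x1 x2 x4 y1 y2 y4 z1 z2 z4
   + (p3 * q4 - p4 * q3) * minor x1 x2 x5 y1 y2 y5 z1 z2 z5
   + (p2 * q5 - p5 * q2) * minor x1 x3 x4 y1 y3 y4 z1 z3 z4
   - (p2 * q4 - p4 * q2) * minor x1 x3 x5 y1 y3 y5 z1 z3 z5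
   + (p2 * q3 - p3 * q2) * minor x1 x4 x5 y1 y4 y5 z1 z4 z5
   - (p1 * q5 - p5 * q1) * minor x2 x3 x4 y2 y3 y4 z2 z3 z4
   + (p1 * q4 - p4 * q1) * minor x2 x3 x5 y2 y3 y5 z2 z3 z5
   - (p1 * q3 - p3 * q1) * minor x2 x4 x5 y2 y4 y5 z2 z4 z5
   + (p1 * q2 - p2 * q1) * minor x3 x4 x5 y3 y4 y5 z3 z4 z5"
  unfolding vol5_def wedge_list_def wedge_Cons interior_def unit_form_def foldr.simps comp_def id_def wedge_Nil
  by simp algebra

lemma real5_linear_eq:
  fixes f g :: "real5 \<Rightarrow> 'b::real_vector"
  assumes "linear f" "linear g"
    and "f (1, 0, 0, 0, 0) = g (1, 0, 0, 0, 0)" "f (0, 1, 0, 0, 0) = g (0, 1, 0, 0, 0)"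
      "f (0, 0, 1, 0, 0) = g (0, 0, 1, 0, 0)" "f (0, 0, 0, 1, 0) = g (0, 0, 0, 1, 0)"
      "f (0, 0, 0, 0, 1) = g (0, 0, 0, 0, 1)"
  shows "f x = g x"
proof -
  obtain x1 x2 x3 x4 x5 where "x = (x1, x2, x3, x4, x5)" by (cases x)
  then have "x = x1 *\<^sub>R (1, 0, 0, 0, 0) + x2 *\<^sub>R (0, 1, 0, 0, 0) + x3 *\<^sub>R (0, 0, 1, 0, 0)
      + x4 *\<^sub>R (0, 0, 0, 1, 0) + x5 *\<^sub>R (0, 0, 0, 0, 1)"
    by simp
  then show ?thesis
    using assms(3-) by (simp only: linear_add[OF assms(1)] linear_add[OF assms(2)]
        linear_cmul[OF assms(1)] linear_cmul[OF assms(2)])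
qed

text \<open>
  The hypotheses say that the derivation with coefficients \<open>a\<close> annihilates the three-form with components
  \<open>g\<close>, the Hodge dual of which is the operator with coefficients \<open>g345, - g245, \<dots>, g123\<close>.
\<close>

lemma skew5_commute:
  fixes a12 a13 a14 a15 a23 a24 a25 a34 a35 a45 g123 g124 g125 g134 g135 g145 g234 g235 g245 g345 :: real
  assumes
    "a14 * g234 + a15 * g235 - a24 * g134 - a25 * g135 + a34 * g124 + a35 * g125 = 0"
    "- a13 * g234 + a15 * g245 + a23 * g134 - a25 * g145 - a34 * g123 + a45 * g125 = 0"
    "- a13 * g235 - a14 * g245 + a23 * g135 + a24 * g145 - a35 * g123 - a45 * g124 = 0"
    "a12 * g234 + a15 * g345 - a23 * g124 - a35 * g145 + a24 * g123 + a45 * g135 = 0"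
    "a12 * g235 - a14 * g345 - a23 * g125 + a34 * g145 + a25 * g123 - a45 * g134 = 0"
    "a12 * g245 + a13 * g345 - a24 * g125 - a34 * g135 + a25 * g124 + a35 * g134 = 0"
    "- a12 * g134 + a25 * g345 + a13 * g124 - a35 * g245 - a14 * g123 + a45 * g235 = 0"
    "- a12 * g135 - a24 * g345 + a13 * g125 + a34 * g245 - a15 * g123 - a45 * g234 = 0"
    "- a12 * g145 + a23 * g345 + a14 * g125 - a34 * g235 - a15 * g124 + a35 * g234 = 0"
    "- a13 * g145 - a23 * g245 + a14 * g135 + a24 * g235 - a15 * g134 - a25 * g234 = 0"
  shows "skew5 a12 a13 a14 a15 a23 a24 a25 a34 a35 a45 (skew5 g345 (- g245) g235 (- g234) g145 (- g135) g134
      g125 (- g124) g123 x) =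
    skew5 g345 (- g245) g235 (- g234) g145 (- g135) g134 g125 (- g124) g123 (skew5 a12 a13 a14 a15 a23 a24 a25
        a34 a35 a45 x)"
  by (rule real5_linear_eq[OF linear_compose[OF linear_skew5 linear_skew5, unfolded comp_def]
        linear_compose[OF linear_skew5 linear_skew5, unfolded comp_def]])
     (use assms in \<open>simp add: algebra_simps\<close>)+

lemma forms3_expand5:
  fixes F :: "'v::real_vector form" and e :: "nat \<Rightarrow> 'v"
  assumes F: "F \<in> forms 3"
  shows "F
     [x1 *\<^sub>R e 1 + x2 *\<^sub>R e 2 + x3 *\<^sub>R e 3 + x4 *\<^sub>R e 4 + x5 *\<^sub>R e 5,
      y1 *\<^sub>R e 1 + y2 *\<^sub>R e 2 + y3 *\<^sub>R e 3 + y4 *\<^sub>R e 4 + y5 *\<^sub>R e 5,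
      z1 *\<^sub>R e 1 + z2 *\<^sub>R e 2 + z3 *\<^sub>R e 3 + z4 *\<^sub>R e 4 + z5 *\<^sub>R e 5] =
    F [e 1, e 2, e 3] * minor x1 x2 x3 y1 y2 y3 z1 z2 z3
    + F [e 1, e 2, e 4] * minor x1 x2 x4 y1 y2 y4 z1 z2 z4
    + F [e 1, e 2, e 5] * minor x1 x2 x5 y1 y2 y5 z1 z2 z5
    + F [e 1, e 3, e 4] * minor x1 x3 x4 y1 y3 y4 z1 z3 z4
    + F [e 1, e 3, e 5] * minor x1 x3 x5 y1 y3 y5 z1 z3 z5
    + F [e 1, e 4, e 5] * minor x1 x4 x5 y1 y4 y5 z1 z4 z5
    + F [e 2, e 3, e 4] * minor x2 x3 x4 y2 y3 y4 z2 z3 z4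
    + F [e 2, e 3, e 5] * minor x2 x3 x5 y2 y3 y5 z2 z3 z5
    + F [e 2, e 4, e 5] * minor x2 x4 x5 y2 y4 y5 z2 z4 z5
    + F [e 3, e 4, e 5] * minor x3 x4 x5 y3 y4 y5 z3 z4 z5"
proof -
  note linear_add[OF forms3_linear1[OF F]] linear_cmul[OF forms3_linear1[OF F]]
    linear_add[OF forms3_linear2[OF F]] linear_cmul[OF forms3_linear2[OF F]]
    linear_add[OF forms3_linear3[OF F]] linear_cmul[OF forms3_linear3[OF F]]
    forms3_repeat[OF F] forms3_sort[OF F]
  then show ?thesis by (simp del: One_nat_def) (simp add: algebra_simps del: One_nat_def)
qed


section \<open>Frames\<close>

text \<open>The condition on \<open>e 0\<close> says that its square is \<open>1\<close> or
  \<open>- 1\<close>, which treats both signatures at once; \<open>e 1\<close> to \<open>e 5\<close>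
  always span a euclidean space.\<close>

definition frame :: "('v::real_vector \<Rightarrow> 'v \<Rightarrow> real) \<Rightarrow> (nat \<Rightarrow> 'v) \<Rightarrow> bool" where
  "frame B e \<longleftrightarrow> B (e 0) (e 0) * B (e 0) (e 0) = 1 \<and> (\<forall>i<6. 0 < i \<longrightarrow> B (e i) (e i) = 1) \<and>
     (\<forall>i<6. \<forall>j<6. i \<noteq> j \<longrightarrow> B (e i) (e j) = 0)"

lemma sum_lessThan_6: "(\<Sum>i<6. f i) = f 0 + f 1 + f 2 + f 3 + f 4 + f (5::nat)"
  by (simp add: eval_nat_numeral)

lemma frame_square: "frame B e \<Longrightarrow> i < 6 \<Longrightarrow> B (e i) (e i) * B (e i) (e i) = 1"
  by (cases "i = 0") (auto simp: frame_def)

text \<open>Each \<open>B (e i) (e i)\<close> is its own inverse, hence the coefficients. The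
  difference of the two sides is orthogonal to a spanning family and vanishes by
  nondegeneracy.\<close>

lemma frame_expansion:
  fixes B :: "'v::real_vector \<Rightarrow> 'v \<Rightarrow> real"
  assumes dim: "dim (UNIV :: 'v set) = 6" and B: "inner_product B" and e: "frame B e"
  shows "x = (\<Sum>i<6. (B (e i) (e i) * B x (e i)) *\<^sub>R e i)"
proof -
  have bil: "bilinear B" using B by (simp add: inner_product_def)
  have lin1: "linear (\<lambda>x. B x y)" and lin2: "linear (B y)" for y using bil by (auto simp: bilinear_def)
  note B_simps = linear_sum[OF lin1] linear_cmul[OF lin1] linear_diff[OF lin1] linear_0[OF lin1]
  have B_sum: "B (\<Sum>i<6. c i *\<^sub>R e i) (e j) = c j * B (e j) (e j)" if "j < 6" for c j
  proof -
    have "B (\<Sum>i<6. c i *\<^sub>R e i) (e j) = (\<Sum>i<6. if i = j then c j * B (e j) (e j) else 0)"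
      unfolding B_simps using e that by (intro sum.cong) (auto simp: frame_def)
    then show ?thesis using that by simp
  qed
  have inj: "inj_on e {..<6}"
  proof (rule inj_onI)
    fix i j assume ij: "i \<in> {..<6::nat}" "j \<in> {..<6::nat}" "e i = e j"
    then have "B (e i) (e j) \<noteq> 0" using frame_square[OF e, of i] by auto
    then show "i = j" using e ij(1,2) unfolding frame_def by (metis lessThan_iff)
  qed
  obtain b :: "'v set" where b: "independent b" "span b = UNIV" "card b = dim (UNIV :: 'v set)"
    using basis_exists[of "UNIV :: 'v set"] by (metis top.extremum_uniqueI)
  then have finb: "finite b" using dim card_ge_0_finite[of b] by simp
  \<comment> \<open>Supplies finite-dimensional linear algebra on \<open>'v\<close>, for the count
    by which six independent vectors span.\<close>
  interpret fd: finite_dimensional_vector_space "scaleR :: real \<Rightarrow> 'v \<Rightarrow> 'v" b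
    using b finb by unfold_locales (auto simp: span_raw_def dependent_raw_def)
  have ind: "independent (e ` {..<6})"
  proof (rule independent_if_scalars_zero)
    fix f x assume f: "(\<Sum>x\<in>e ` {..<6}. f x *\<^sub>R x) = 0" and "x \<in> e ` {..<6}"
    then obtain j where j: "j < 6" "x = e j" by auto
    have "(\<Sum>i<6. f (e i) *\<^sub>R e i) = 0" using f inj by (simp add: sum.reindex)
    then have "f (e j) * B (e j) (e j) = 0" using B_sum[OF j(1), of "\<lambda>i. f (e i)"] by (simp add: B_simps)
    then show "f x = 0" using frame_square[OF e j(1)] j(2) by auto
  qed simp
  have "card (e ` {..<6}) = 6" using inj by (simp add: card_image)
  then have span: "span (e ` {..<6}) = UNIV"
    using fd.card_ge_dim_independent[of "e ` {..<6}" UNIV] ind dim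
    by (auto simp: span_raw_def dependent_raw_def dim_raw_def)
  define y where "y = x - (\<Sum>i<6. (B (e i) (e i) * B x (e i)) *\<^sub>R e i)"
  have "B y (e j) = 0" if "j < 6" for j
    unfolding y_def B_simps(3) B_sum[OF that] using frame_square[OF e that] by (simp add: algebra_simps)
  then have "B y v = 0" for v
    using linear_eq_on_span[OF lin2[of y] linear_zero, of "e ` {..<6}" v] span by auto
  then have "y = 0" using B by (simp add: inner_product_def)
  then show ?thesis by (simp add: y_def)
qed

lemma sharp_frame:
  fixes B :: "'v::real_vector \<Rightarrow> 'v \<Rightarrow> real"
  assumes dim: "dim (UNIV :: 'v set) = 6" and B: "inner_product B" and e: "frame B e" and lin: "linear \<alpha>"
  shows "sharp B \<alpha> = (\<Sum>i<6. (B (e i) (e i) * \<alpha> (e i)) *\<^sub>R e i)"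
proof (rule sharp_unique[OF B])
  fix v
  have lin1: "linear (\<lambda>x. B x y)" for y using B by (simp add: inner_product_def bilinear_def)
  have sym: "B u w = B w u" for u w using B by (auto simp: inner_product_def)
  have "B (\<Sum>i<6. (B (e i) (e i) * \<alpha> (e i)) *\<^sub>R e i) v = (\<Sum>i<6. B (e i) (e i) * B v (e i) * \<alpha> (e i))"
    using B by (simp add: linear_sum[OF lin1] linear_cmul[OF lin1] sym[of v] mult_ac)
  also have "\<dots> = \<alpha> v"
    by (subst (2) frame_expansion[OF dim B e, of v]) (simp add: linear_sum[OF lin] linear_cmul[OF lin])
  finally show "B (\<Sum>i<6. (B (e i) (e i) * \<alpha> (e i)) *\<^sub>R e i) v = \<alpha> v" .
qed

text \<open>Alternation passes from increasing to arbitrary index triples, multilinearity from the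
  frame to all vectors.\<close>

lemma forms3_eq_on_frame:
  fixes F G :: "'v::real_vector form"
  assumes dim: "dim (UNIV :: 'v set) = 6" and B: "inner_product B" and e: "frame B e"
    and F: "F \<in> forms 3" and G: "G \<in> forms 3"
    and eq: "\<And>i j k. i < j \<Longrightarrow> j < k \<Longrightarrow> k < 6 \<Longrightarrow> F [e i, e j, e k] = G [e i, e j, e k]"
  shows "F = G"
proof -
  have triple: "F [e i, e j, e k] = G [e i, e j, e k]" if "i < 6" "j < 6" "k < 6" for i j k
  proof (cases "distinct [i, j, k]")
    case True
    then consider "i < j" "j < k" | "i < k" "k < j" | "j < i" "i < k" | "j < k" "k < i"
      | "k < i" "i < j" | "k < j" "j < i" by fastforce
    then show ?thesis
    proof cases
      case 1
      then show ?thesis using eq that by blast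
    next
      case 2
      then have "F [e i, e k, e j] = G [e i, e k, e j]" using eq that by blast
      then show ?thesis using forms3_swap23[OF F, of "e i" "e k" "e j"] forms3_swap23[OF G, of "e i" "e k" "e
          j"] by simp
    next
      case 3
      then have "F [e j, e i, e k] = G [e j, e i, e k]" using eq that by blast
      then show ?thesis using forms3_swap12[OF F, of "e i" "e j" "e k"] forms3_swap12[OF G, of "e i" "e j" "e
          k"] by simp
    next
      case 4
      then have "F [e j, e k, e i] = G [e j, e k, e i]" using eq that by blast
      then show ?thesis
        using forms3_swap12[OF F, of "e i" "e j" "e k"] forms3_swap12[OF G, of "e i" "e j" "e k"]
          forms3_swap23[OF F, of "e j" "e i" "e k"] forms3_swap23[OF G, of "e j" "e i" "e k"] by simp
    next
      case 5
      then have "F [e k, e i, e j] = G [e k, e i, e j]" using eq that by blast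
      then show ?thesis
        using forms3_swap23[OF F, of "e i" "e j" "e k"] forms3_swap23[OF G, of "e i" "e j" "e k"]
          forms3_swap12[OF F, of "e i" "e k" "e j"] forms3_swap12[OF G, of "e i" "e k" "e j"] by simp
    next
      case 6
      then have "F [e k, e j, e i] = G [e k, e j, e i]" using eq that by blast
      then show ?thesis
        using forms3_swap12[OF F, of "e i" "e j" "e k"] forms3_swap12[OF G, of "e i" "e j" "e k"]
          forms3_swap23[OF F, of "e j" "e i" "e k"] forms3_swap23[OF G, of "e j" "e i" "e k"]
          forms3_swap12[OF F, of "e j" "e k" "e i"] forms3_swap12[OF G, of "e j" "e k" "e i"] by simp
    qed
  next
    case False
    then have "\<not> distinct [e i, e j, e k]" by auto
    then show ?thesis using forms_not_distinct[OF F] forms_not_distinct[OF G] by simp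
  qed
  define c where "c x i = B (e i) (e i) * B x (e i)" for x i
  have "H [x, y, z] = (\<Sum>i<6. c x i * (\<Sum>j<6. c y j * (\<Sum>k<6. c z k * H [e i, e j, e k])))"
    if H: "H \<in> forms 3" for x y z and H :: "'v form"
  proof -
    have ex: "v = (\<Sum>i<6. c v i *\<^sub>R e i)" for v unfolding c_def by (rule frame_expansion[OF dim B e])
    have 1: "H [x, y, z] = (\<Sum>i<6. c x i * H [e i, y, z])"
      by (subst ex[of x]) (simp add: linear_sum[OF forms3_linear1[OF H]] linear_cmul[OF forms3_linear1[OF H]])
    have 2: "H [e i, y, z] = (\<Sum>j<6. c y j * H [e i, e j, z])" for i
      by (subst ex[of y]) (simp add: linear_sum[OF forms3_linear2[OF H]] linear_cmul[OF forms3_linear2[OF H]])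
    have 3: "H [e i, e j, z] = (\<Sum>k<6. c z k * H [e i, e j, e k])" for i j
      by (subst ex[of z]) (simp add: linear_sum[OF forms3_linear3[OF H]] linear_cmul[OF forms3_linear3[OF H]])
    show ?thesis unfolding 1 2 3 ..
  qed
  note expand = this
  have eq3: "F [x, y, z] = G [x, y, z]" for x y z
    unfolding expand[OF F, of x y z] expand[OF G, of x y z]
    by (intro sum.cong refl arg_cong2[of _ _ _ _ "(*)"]) (simp add: triple)
  have "F vs = G vs" for vs
  proof (cases "length vs = 3")
    case True
    then show ?thesis using eq3 by (auto simp: numeral_3_eq_3 length_Suc_conv)
  qed (simp add: forms_length[OF F] forms_length[OF G])
  then show ?thesis by blast
qed

section \<open>Existence of frames in both signatures\<close>

lemma has_signature_frame:
  assumes B: "has_signature B 1 5" and sym: "\<And>u v. B u v = B v u"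
  shows "\<exists>e. frame B e"
proof -
  obtain T S where TS: "finite S" "T \<inter> S = {}" "card T = 1" "card S = 5"
      "\<forall>u\<in>T \<union> S. \<forall>v\<in>T \<union> S. u \<noteq> v \<longrightarrow> B u v = 0" "\<forall>v\<in>T. B v v = - 1" "\<forall>v\<in>S. B v v = 1"
    using B by (auto simp: has_signature_def)
  obtain t where t: "T = {t}" using TS(3) by (auto simp: card_1_singleton_iff)
  obtain h where h: "bij_betw h {1..5::nat} S" using ex_bij_betw_nat_finite_1[OF TS(1)] TS(4) by metis
  have hS: "h i \<in> S" if "0 < i" "i < 6" for i using bij_betw_apply[OF h] that by simp
  have "h i \<noteq> h j" if "i \<noteq> j" "0 < i" "i < 6" "0 < j" "j < 6" for i j
    using bij_betw_imp_inj_on[OF h] that by (auto simp: inj_on_def)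
  moreover have "B t s = 0" "B s t = 0" if "s \<in> S" for s using TS(2,5) t that by auto
  ultimately have "frame B (\<lambda>i. if i = 0 then t else h i)"
    using TS(5-7) hS t by (auto simp: frame_def)
  then show ?thesis by blast
qed

text \<open>Gram-Schmidt: fewer than six vectors do not span, and a vector outside the span is made
  orthogonal to the others and normalized.\<close>

lemma euclidean_frame:
  fixes B :: "'v::real_vector \<Rightarrow> 'v \<Rightarrow> real"
  assumes dim: "dim (UNIV :: 'v set) = 6" and B: "inner_product B" "euclidean_signature B"
  shows "\<exists>e. frame B e"
proof -
  have bil: "bilinear B" and sym: "\<And>u v. B u v = B v u" using B(1) by (auto simp: inner_product_def)
  have lin1: "linear (\<lambda>x. B x y)" for y using bil by (simp add: bilinear_def)
  note B_simps = linear_sum[OF lin1] linear_cmul[OF lin1] linear_diff[OF lin1]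
  have "\<exists>S. finite S \<and> card S = n \<and> (\<forall>u\<in>S. \<forall>v\<in>S. B u v = (if u = v then 1 else 0))" if "n \<le> 6" for n
    using that
  proof (induction n)
    case 0
    then show ?case by (intro exI[of _ "{}"]) simp
  next
    case (Suc n)
    then obtain S where S: "finite S" "card S = n" "\<And>u v. u \<in> S \<Longrightarrow> v \<in> S \<Longrightarrow> B u v = (if u = v then 1 else 0)"
      by fastforce
    have "span S \<noteq> UNIV"
    proof
      assume "span S = UNIV"
      then have "dim (UNIV :: 'v set) \<le> card S" using S(1) by (metis dim_le_card dim_span order_refl)
      then show False using dim S(2) Suc.prems by simp
    qed
    then obtain v where v: "v \<notin> span S" by blast
    define w where "w = v - (\<Sum>s\<in>S. B v s *\<^sub>R s)"
    have "(\<Sum>s\<in>S. B v s *\<^sub>R s) \<in> span S" by (intro span_sum span_scale span_base)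
    then have "w \<noteq> 0" using v by (auto simp: w_def)
    then have ww: "0 < B w w" using B(2) by (simp add: euclidean_signature_def)
    have wS: "B w s = 0" if "s \<in> S" for s
    proof -
      have "(\<Sum>r\<in>S. B v r * B r s) = (\<Sum>r\<in>S. if r = s then B v s else 0)"
        using S(3) that by (intro sum.cong) auto
      then show ?thesis using S(1) that by (simp add: w_def B_simps)
    qed
    define u where "u = (1 / sqrt (B w w)) *\<^sub>R w"
    have uS: "B u s = 0" "B s u = 0" if "s \<in> S" for s
      using wS[OF that] sym[of s u] by (simp_all add: u_def B_simps)
    have uu: "B u u = 1" using ww sym[of w u]
      by (simp add: u_def bilinear_lmul[OF bil] bilinear_rmul[OF bil])
    have "u \<notin> S" using uS(1)[of u] uu by auto
    then show ?case using S uS uu by (intro exI[of _ "insert u S"]) auto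
  qed
  from this[of 6] obtain S where S: "finite S" "card S = 6" "\<And>u v. u \<in> S \<Longrightarrow> v \<in> S \<Longrightarrow> B u v = (if u = v then 1 else 0)"
    by auto
  obtain e where e: "bij_betw e {0..<6::nat} S" using ex_bij_betw_nat_finite[OF S(1)] S(2) by metis
  have eS: "e i \<in> S" if "i < 6" for i using bij_betw_apply[OF e] that by simp
  have "e i \<noteq> e j" if "i \<noteq> j" "i < 6" "j < 6" for i j
    using bij_betw_imp_inj_on[OF e] that by (auto simp: inj_on_def)
  then have "frame B e" using S(3) eS by (auto simp: frame_def)
  then show ?thesis by blast
qed


section \<open>Normal form\<close>

definition jacobi :: "('v::real_vector \<Rightarrow> 'v \<Rightarrow> real) \<Rightarrow> 'v form \<Rightarrow> bool" where
  "jacobi B F \<longleftrightarrow> (\<forall>X x y z. F [sharp B (\<lambda>v. F [X, x, v]), y, z] + F [x, sharp B (\<lambda>v. F [X, y, v]), z]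
       + F [x, y, sharp B (\<lambda>v. F [X, z, v])] = 0)"

lemma jacobi_frame:
  fixes B :: "'v::real_vector \<Rightarrow> 'v \<Rightarrow> real"
  assumes dim: "dim (UNIV :: 'v set) = 6" and B: "inner_product B" and e: "frame B e"
    and F: "F \<in> forms 3" and J: "jacobi B F"
  shows "(\<Sum>i<6. B (e i) (e i) * (F [X, x, e i] * F [e i, y, z] + F [X, y, e i] * F [x, e i, z]
     + F [X, z, e i] * F [x, y, e i])) = 0"
proof -
  note sharp = sharp_frame[OF dim B e forms3_linear3[OF F]]
  have "F [sharp B (\<lambda>v. F [X, x, v]), y, z] + F [x, sharp B (\<lambda>v. F [X, y, v]), z]
       + F [x, y, sharp B (\<lambda>v. F [X, z, v])] = 0"
    using J by (simp add: jacobi_def)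
  then show ?thesis
    unfolding sharp linear_sum[OF forms3_linear1[OF F]] linear_sum[OF forms3_linear2[OF F]]
      linear_sum[OF forms3_linear3[OF F]] linear_cmul[OF forms3_linear1[OF F]]
      linear_cmul[OF forms3_linear2[OF F]] linear_cmul[OF forms3_linear3[OF F]]
    by (simp add: sum.distrib[symmetric] algebra_simps)
qed

text \<open>For a frame \<open>e\<close> this is an isometry onto the orthogonal complement of
  \<open>e 0\<close>; it carries the normal form from \<open>real5\<close> back to
  \<open>'v\<close>.\<close>

definition emb :: "(nat \<Rightarrow> 'v) \<Rightarrow> real5 \<Rightarrow> 'v::real_vector" where
  "emb e = (\<lambda>(x1, x2, x3, x4, x5). x1 *\<^sub>R e 1 + x2 *\<^sub>R e 2 + x3 *\<^sub>R e 3 + x4 *\<^sub>R e 4 + x5 *\<^sub>R e 5)"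

text \<open>The equations leave at most four independent components of \<open>F\<close>: those with
  indices \<open>0 1 2\<close>, \<open>0 3 4\<close>, \<open>1 2 5\<close> and \<open>3 4 5\<close>.
  The frame keeps \<open>e 0\<close> and takes the rest from the common normal form of
  \<open>A\<close> and \<open>C\<close>.\<close>

lemma adapted_frame:
  fixes B :: "'v::real_vector \<Rightarrow> 'v \<Rightarrow> real"
  assumes dim: "dim (UNIV :: 'v set) = 6" and B: "inner_product B" and e: "frame B e"
    and F: "F \<in> forms 3" and J: "jacobi B F"
  shows "\<exists>h. frame B h \<and>
    (\<forall>i\<in>{1, 2}. \<forall>j\<in>{3, 4}. F [h 0, h i, h j] = 0 \<and> (\<forall>k\<in>{1..5}. F [h i, h j, h k] = 0)) \<and>
    (\<forall>i\<in>{1..5}. F [h 0, h i, h 5] = 0)"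
proof -
  have bil: "bilinear B" using B by (simp add: inner_product_def)
  have ee: "B (e i) (e j) = (if i = j then 1 else 0)" if "i \<in> {1..5}" "j \<in> {1..5}" for i j
    using e that by (auto simp: frame_def)
  have e0: "B (e 0) (e i) = 0" "B (e i) (e 0) = 0" if "i \<in> {1..5}" for i
    using e that by (auto simp: frame_def)
  define A where "A = skew5
    (F [e 0, e 1, e 2]) (F [e 0, e 1, e 3]) (F [e 0, e 1, e 4]) (F [e 0, e 1, e 5]) (F [e 0, e 2, e 3])
    (F [e 0, e 2, e 4]) (F [e 0, e 2, e 5]) (F [e 0, e 3, e 4]) (F [e 0, e 3, e 5]) (F [e 0, e 4, e 5])"
  \<comment> \<open>the Hodge dual of the restriction of \<open>F\<close> to the span of \<open>e 1, \<dots>, e 5\<close>\<close>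
  define C where "C = skew5
    (F [e 3, e 4, e 5]) (- F [e 2, e 4, e 5]) (F [e 2, e 3, e 5]) (- F [e 2, e 3, e 4]) (F [e 1, e 4, e 5])
    (- F [e 1, e 3, e 5]) (F [e 1, e 3, e 4]) (F [e 1, e 2, e 5]) (- F [e 1, e 2, e 4]) (F [e 1, e 2, e 3])"
  note components = forms3_repeat[OF F] forms3_sort[OF F]
  \<comment> \<open>For \<open>X = e 0\<close> the summand \<open>i = 0\<close> vanishes by
    alternation, which leaves a sum over the euclidean part. The ten triples from \<open>e 1\<close>
    to \<open>e 5\<close> give the ten hypotheses of \<open>skew5_commute\<close>.\<close>
  have comm: "A (C x) = C (A x)" for x
    unfolding A_def C_def
    by (rule skew5_commute)
      (use jacobi_frame[OF dim B e F J, of "e 0" "e 1" "e 2" "e 3"]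
        jacobi_frame[OF dim B e F J, of "e 0" "e 1" "e 2" "e 4"]
        jacobi_frame[OF dim B e F J, of "e 0" "e 1" "e 2" "e 5"]
        jacobi_frame[OF dim B e F J, of "e 0" "e 1" "e 3" "e 4"]
        jacobi_frame[OF dim B e F J, of "e 0" "e 1" "e 3" "e 5"]
        jacobi_frame[OF dim B e F J, of "e 0" "e 1" "e 4" "e 5"]
        jacobi_frame[OF dim B e F J, of "e 0" "e 2" "e 3" "e 4"]
        jacobi_frame[OF dim B e F J, of "e 0" "e 2" "e 3" "e 5"]
        jacobi_frame[OF dim B e F J, of "e 0" "e 2" "e 4" "e 5"]
        jacobi_frame[OF dim B e F J, of "e 0" "e 3" "e 4" "e 5"] in
        \<open>simp_all add: sum_lessThan_6 ee components del: One_nat_def\<close>)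
  interpret commuting_skew A C
  proof (rule commuting_skew.intro)
    show "linear A" "linear C" unfolding A_def C_def by (rule linear_skew5)+
    show "A x \<bullet> y = - (x \<bullet> A y)" "C x \<bullet> y = - (x \<bullet> C y)" for x y
      unfolding A_def C_def by (rule skew5_skew)+
  qed (rule comm)
  have FA: "F [e 0, emb e x, emb e y] = A x \<bullet> y" for x y
    by (cases x, cases y)
      (simp add: emb_def A_def components linear_add[OF forms3_linear2[OF F]] linear_cmul[OF forms3_linear2[OF F]]
        linear_add[OF forms3_linear3[OF F]] linear_cmul[OF forms3_linear3[OF F]] del: One_nat_def,
       simp add: algebra_simps del: One_nat_def)
  obtain f1 f2 f3 f4 f5 a b c d where f:
    "f1 \<bullet> f1 = 1" "f2 \<bullet> f2 = 1" "f3 \<bullet> f3 = 1" "f4 \<bullet> f4 = 1" "f5 \<bullet> f5 = 1"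
    "f1 \<bullet> f2 = 0" "f1 \<bullet> f3 = 0" "f1 \<bullet> f4 = 0" "f1 \<bullet> f5 = 0" "f2 \<bullet> f3 = 0"
    "f2 \<bullet> f4 = 0" "f2 \<bullet> f5 = 0" "f3 \<bullet> f4 = 0" "f3 \<bullet> f5 = 0" "f4 \<bullet> f5 = 0"
    and Af: "\<And>x. A x = a *\<^sub>R ((f1 \<bullet> x) *\<^sub>R f2 - (f2 \<bullet> x) *\<^sub>R f1) + b *\<^sub>R ((f3 \<bullet> x) *\<^sub>R f4 - (f4 \<bullet> x) *\<^sub>R f3)"
    and Cf: "\<And>x. C x = c *\<^sub>R ((f1 \<bullet> x) *\<^sub>R f2 - (f2 \<bullet> x) *\<^sub>R f1) + d *\<^sub>R ((f3 \<bullet> x) *\<^sub>R f4 - (f4 \<bullet> x) *\<^sub>R f3)"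
    by (rule orthonormal_normal_form) auto
  have f': "f2 \<bullet> f1 = 0" "f3 \<bullet> f1 = 0" "f4 \<bullet> f1 = 0" "f5 \<bullet> f1 = 0" "f3 \<bullet> f2 = 0"
    "f4 \<bullet> f2 = 0" "f5 \<bullet> f2 = 0" "f4 \<bullet> f3 = 0" "f5 \<bullet> f3 = 0" "f5 \<bullet> f4 = 0"
    using f by (simp_all add: inner_commute)
  \<comment> \<open>\<open>C\<close> corresponds to the bivector \<open>c f1 \<and> f2 + d f3 \<and> f4\<close>; contract it with the volume form.\<close>
  have FC: "F [emb e x, emb e y, emb e z] = c * vol5 f1 f2 x y z + d * vol5 f3 f4 x y z" for x y z
  proof -
    obtain p1 p2 p3 p4 p5 where p: "f1 = (p1, p2, p3, p4, p5)" by (cases f1)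
    obtain q1 q2 q3 q4 q5 where q: "f2 = (q1, q2, q3, q4, q5)" by (cases f2)
    obtain r1 r2 r3 r4 r5 where r: "f3 = (r1, r2, r3, r4, r5)" by (cases f3)
    obtain s1 s2 s3 s4 s5 where s: "f4 = (s1, s2, s3, s4, s5)" by (cases f4)
    obtain x1 x2 x3 x4 x5 where x: "x = (x1, x2, x3, x4, x5)" by (cases x)
    obtain y1 y2 y3 y4 y5 where y: "y = (y1, y2, y3, y4, y5)" by (cases y)
    obtain z1 z2 z3 z4 z5 where z: "z = (z1, z2, z3, z4, z5)" by (cases z)
    \<comment> \<open>Comparing the two expressions for \<open>C\<close> on four basis vectors
      determines it, because each entry \<open>pij\<close> with \<open>i < j\<close> appears in the
      image of one of the first four.\<close>
    have comps: "F [e 3, e 4, e 5] = (c * (p1 * q2 - q1 * p2) + d * (r1 * s2 - s1 * r2))"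
      "F [e 2, e 4, e 5] = - (c * (p1 * q3 - q1 * p3) + d * (r1 * s3 - s1 * r3))"
      "F [e 2, e 3, e 5] = (c * (p1 * q4 - q1 * p4) + d * (r1 * s4 - s1 * r4))"
      "F [e 2, e 3, e 4] = - (c * (p1 * q5 - q1 * p5) + d * (r1 * s5 - s1 * r5))"
      "F [e 1, e 4, e 5] = (c * (p2 * q3 - q2 * p3) + d * (r2 * s3 - s2 * r3))"
      "F [e 1, e 3, e 5] = - (c * (p2 * q4 - q2 * p4) + d * (r2 * s4 - s2 * r4))"
      "F [e 1, e 3, e 4] = (c * (p2 * q5 - q2 * p5) + d * (r2 * s5 - s2 * r5))"
      "F [e 1, e 2, e 5] = (c * (p3 * q4 - q3 * p4) + d * (r3 * s4 - s3 * r4))"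
      "F [e 1, e 2, e 4] = - (c * (p3 * q5 - q3 * p5) + d * (r3 * s5 - s3 * r5))"
      "F [e 1, e 2, e 3] = (c * (p4 * q5 - q4 * p5) + d * (r4 * s5 - s4 * r5))"
      using Cf[of "(1, 0, 0, 0, 0)"] Cf[of "(0, 1, 0, 0, 0)"] Cf[of "(0, 0, 1, 0, 0)"] Cf[of "(0, 0, 0, 1, 0)"]
      by (simp_all add: C_def p q r s minus_equation_iff[of "F _"] del: One_nat_def)
    show ?thesis
      unfolding x y z p q r s emb_def prod.case forms3_expand5[OF F] comps vol5_expand by algebra
  qed
  have emb0: "B (e 0) (emb e x) = 0" "B (emb e x) (e 0) = 0" for x
    by (cases x, simp add: emb_def bilinear_radd[OF bil] bilinear_rmul[OF bil]
        bilinear_ladd[OF bil] bilinear_lmul[OF bil] e0 del: One_nat_def)+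
  have emb: "B (emb e x) (emb e y) = x \<bullet> y" for x y
    by (cases x, cases y, simp add: emb_def bilinear_radd[OF bil] bilinear_rmul[OF bil]
        bilinear_ladd[OF bil] bilinear_lmul[OF bil] ee del: One_nat_def)
  define h where "h i = (if i = 0 then e 0 else emb e ([f1, f2, f3, f4, f5] ! (i - 1)))" for i
  have h: "h 0 = e 0" "h 1 = emb e f1" "h 2 = emb e f2" "h 3 = emb e f3" "h 4 = emb e f4" "h 5 = emb e f5"
    by (simp_all add: h_def)
  have lt6: "(\<forall>i<6. P i) \<longleftrightarrow> P 0 \<and> P 1 \<and> P 2 \<and> P 3 \<and> P 4 \<and> P 5" for P :: "nat \<Rightarrow> bool"
    by (simp add: eval_nat_numeral less_Suc_eq all_conj_distrib)
  have "B (e 0) (e 0) * B (e 0) (e 0) = 1" using e by (simp add: frame_def)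
  then have "frame B h"
    unfolding frame_def lt6 h by (simp add: emb emb0 f f' del: One_nat_def)
  moreover have "{1..5} = {1, 2, 3, 4, 5::nat}" by auto
  \<comment> \<open>For \<open>i\<close> in \<open>{1, 2}\<close> and \<open>j\<close> in
    \<open>{3, 4}\<close> both determinants in \<open>FC\<close> have a repeated argument,
    \<open>i\<close> in the first and \<open>j\<close> in the second. The components with
    \<open>h 0\<close> are read off from \<open>A\<close>.\<close>
  ultimately show ?thesis
    by (intro exI[of _ h]) (simp add: h FA FC Af f f' vol5_not_distinct inner_diff_left inner_add_left del:
        One_nat_def)
qed

text \<open>The surviving components are grouped by the planes of \<open>e 1, e 2\<close> and
  \<open>e 3, e 4\<close>, with the contractions \<open>\<gamma>\<close> and \<open>\<delta>\<close>
  as third factors. Their duals lie in the span of \<open>e 0\<close> and \<open>e 5\<close>; in the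
  lorentzian case they may share a null direction.\<close>

lemma adapted_frame_decomposition:
  fixes B :: "'v::real_vector \<Rightarrow> 'v \<Rightarrow> real"
  assumes dim: "dim (UNIV :: 'v set) = 6" and B: "inner_product B" and e: "frame B e"
    and F: "F \<in> forms 3" and J: "jacobi B F"
    and 0: "\<And>i j. i \<in> {1, 2} \<Longrightarrow> j \<in> {3, 4} \<Longrightarrow> F [e 0, e i, e j] = 0"
    and 1: "\<And>i j k. i \<in> {1, 2} \<Longrightarrow> j \<in> {3, 4} \<Longrightarrow> k \<in> {1..5} \<Longrightarrow> F [e i, e j, e k] = 0"
    and 2: "\<And>i. i \<in> {1..5} \<Longrightarrow> F [e 0, e i, e 5] = 0"
  shows "\<exists>F1 F2. simple_form 3 F1 \<and> simple_form 3 F2 \<and> orthogonal_forms B F1 F2 \<and> F = F1 + F2"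
proof -
  have bil: "bilinear B" and sym: "\<And>u v. B u v = B v u" using B by (auto simp: inner_product_def)
  have lin: "linear (B x)" and lin1: "linear (\<lambda>x. B x y)" for x y using bil by (simp_all add: bilinear_def)
  have pos: "0 < dim (UNIV :: 'v set)" using dim by simp
  define \<gamma> where "\<gamma> v = F [e 1, e 2, v]" for v
  define \<delta> where "\<delta> v = F [e 3, e 4, v]" for v
  have lin\<gamma>: "linear \<gamma>" and lin\<delta>: "linear \<delta>"
    unfolding \<gamma>_def \<delta>_def by (rule forms3_linear3[OF F])+
  let ?F1 = "wedge_list [B (e 1), B (e 2), \<gamma>]" and ?F2 = "wedge_list [B (e 3), B (e 4), \<delta>]"
  note components = forms3_repeat[OF F] forms3_sort[OF F]
  have ee: "B (e i) (e j) = (if i = j then 1 else 0)" if "i \<in> {1..5}" "j \<in> {1..5}" for i j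
    using e that by (auto simp: frame_def)
  have e0: "B (e 0) (e i) = 0" "B (e i) (e 0) = 0" if "i \<in> {1..5}" for i
    using e that by (auto simp: frame_def)
  have \<gamma>: "\<gamma> (e 1) = 0" "\<gamma> (e 2) = 0" "\<gamma> (e 3) = 0" "\<gamma> (e 4) = 0"
    using 1[of 1 3 2] 1[of 1 4 2] by (simp_all add: \<gamma>_def components del: One_nat_def)
  have \<delta>: "\<delta> (e 1) = 0" "\<delta> (e 2) = 0" "\<delta> (e 3) = 0" "\<delta> (e 4) = 0"
    using 1[of 1 3 4] 1[of 2 3 4] by (simp_all add: \<delta>_def components del: One_nat_def)
  have simple: "simple_form 3 ?F1" "simple_form 3 ?F2"
    unfolding simple_form_def using lin lin\<gamma> lin\<delta> by (metis list.set(1) list.set(2) empty_iff insert_iff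
        length_Cons list.size(3) numeral_3_eq_3)+
  have eq: "F = ?F1 + ?F2"
  proof (rule forms3_eq_on_frame[OF dim B e F forms_plus[OF simple[THEN simple_form_in_forms]]])
    fix i j k :: nat assume "i < j" "j < k" "k < 6"
    then have "(i, j, k) \<in> {
      (0, 1, 2), (0, 1, 3), (0, 1, 4), (0, 1, 5), (0, 2, 3), (0, 2, 4), (0, 2, 5), (0, 3, 4), (0, 3, 5), (0,
          4, 5), (1, 2, 3), (1, 2, 4), (1, 2, 5), (1, 3, 4), (1, 3, 5), (1, 4, 5), (2, 3, 4), (2, 3, 5), (2,
          4, 5), (3, 4, 5)}"
    proof -
      have "k = 0 \<or> k = 1 \<or> k = 2 \<or> k = 3 \<or> k = 4 \<or> k = 5"
        "j = 0 \<or> j = 1 \<or> j = 2 \<or> j = 3 \<or> j = 4 \<or> j = 5"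
        "i = 0 \<or> i = 1 \<or> i = 2 \<or> i = 3 \<or> i = 4 \<or> i = 5"
        using \<open>i < j\<close> \<open>j < k\<close> \<open>k < 6\<close> by linarith+
      then show ?thesis using \<open>i < j\<close> \<open>j < k\<close> by (elim disjE) simp_all
    qed
    then show "F [e i, e j, e k] = (?F1 + ?F2) [e i, e j, e k]"
      using 0[of 1 3] 0[of 1 4] 0[of 2 3] 0[of 2 4] 1[of 1 3 2] 1[of 1 4 2] 1[of 1 3 4] 1[of 2 3 4] 1[of 1 3 5]
        1[of 1 4 5] 1[of 2 3 5] 1[of 2 4 5] 2[of 1] 2[of 2] 2[of 3] 2[of 4]
      by (auto simp: wedge_list_three \<gamma> \<delta> ee e0 components simp del: One_nat_def)
        (simp_all add: \<gamma>_def \<delta>_def components del: One_nat_def)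
  qed
  have sharp\<gamma>: "B (sharp B \<gamma>) v = \<gamma> v" and sharp\<delta>: "B (sharp B \<delta>) v = \<delta> v" for v
    by (rule inner_sharp[OF B pos lin\<gamma>] inner_sharp[OF B pos lin\<delta>])+
  have F_zero: "F [e 1, e 3, v] = 0" "F [e 1, e 4, v] = 0" for v
    by (subst eq, simp add: wedge_list_three \<gamma> \<delta> ee del: One_nat_def)+
  have "sharp B (\<lambda>v. 0) = 0" by (rule sharp_unique[OF B]) (simp add: bilinear_lzero[OF bil])
  \<comment> \<open>Since \<open>[e 1, e 3] = [e 1, e 4] = 0\<close>, the Jacobi identity for
    \<open>X = e 1\<close> on \<open>e 2, e 3, e 4\<close> retains only the term with
    \<open>[e 1, e 2] = sharp B \<gamma>\<close>. It says that the duals of \<open>\<gamma>\<close>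
    and \<open>\<delta>\<close> are orthogonal.\<close>
  then have "F [sharp B \<gamma>, e 3, e 4] = 0"
    using J[unfolded jacobi_def, rule_format, of "e 1" "e 2" "e 3" "e 4"]
    by (simp add: F_zero \<gamma>_def[abs_def] linear_0[OF forms3_linear2[OF F]] linear_0[OF forms3_linear3[OF F]]
        del: One_nat_def)
  then have \<gamma>\<delta>: "\<delta> (sharp B \<gamma>) = 0"
    unfolding \<delta>_def using forms3_swap12[OF F] forms3_swap23[OF F] by (metis neg_0_equal_iff_equal)
  have B0: "B x y = 0" if "x \<in> {e 1, e 2, sharp B \<gamma>}" "y \<in> {e 3, e 4, sharp B \<delta>}" for x y
    using that \<gamma>\<delta> sharp\<delta>[of x] by (auto simp: sharp\<gamma> \<gamma> \<delta> ee sym[of _ "sharp B \<delta>"] simp del: One_nat_def)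
  have "B x y = 0" if "x \<in> span {e 1, e 2, sharp B \<gamma>}" "y \<in> span {e 3, e 4, sharp B \<delta>}" for x y
  proof -
    have "B x v = 0" if "v \<in> {e 3, e 4, sharp B \<delta>}" for v
      using linear_eq_on_span[OF lin1[of v] linear_zero, of "{e 1, e 2, sharp B \<gamma>}" x] B0 that \<open>x \<in> _\<close> by auto
    then show ?thesis
      using linear_eq_on_span[OF lin[of x] linear_zero, of "{e 3, e 4, sharp B \<delta>}" y] \<open>y \<in> _\<close> by auto
  qed
  moreover have "sharp B (B v) = v" for v by (rule sharp_unique[OF B]) simp
  \<comment> \<open>The planes are identified only for nonzero summands; a zero summand is
    orthogonal by definition.\<close>
  ultimately have "orthogonal_forms B ?F1 ?F2"
    using form_plane_wedge_list[OF B pos, of "[B (e 1), B (e 2), \<gamma>]"]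
      form_plane_wedge_list[OF B pos, of "[B (e 3), B (e 4), \<delta>]"] lin lin\<gamma> lin\<delta>
    by (auto simp: orthogonal_forms_def)
  then show ?thesis using simple eq by blast
qed

section \<open>The equivalence\<close>

theorem mainTheorem1:
  fixes B :: "'v::real_vector \<Rightarrow> 'v \<Rightarrow> real" and F :: "'v form"
  assumes "dim (UNIV :: 'v set) = 6"
    and "inner_product B"
    and "euclidean_signature B \<or> lorentzian_signature B"
    and "F \<in> forms 3"
  shows "(\<forall>X. bracket B (\<iota> X F) F = 0) \<longleftrightarrow>
    (\<exists>F1 F2. simple_form 3 F1 \<and> simple_form 3 F2 \<and> orthogonal_forms B F1 F2 \<and> F = F1 + F2)"
proof -
  have pos: "0 < dim (UNIV :: 'v set)" using assms(1) by simp
  have sym: "\<And>u v. B u v = B v u" using assms(2) by (auto simp: inner_product_def)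
  note iff = bracket_interior_eq_zero_iff[OF assms(2) pos assms(4)]
  show ?thesis
  proof
    assume "\<forall>X. bracket B (\<iota> X F) F = 0"
    then have J: "jacobi B F" unfolding jacobi_def iff .
    \<comment> \<open>The two signatures are distinguished only here; once a frame exists the
      argument is uniform.\<close>
    have "\<exists>e. frame B e"
      using assms(1,3) euclidean_frame[OF assms(1,2)] has_signature_frame[of B] sym
      by (auto simp: lorentzian_signature_def)
    then obtain e where "frame B e" ..
    from adapted_frame[OF assms(1,2) this assms(4) J] obtain h where "frame B h"
      "\<forall>i\<in>{1, 2}. \<forall>j\<in>{3, 4}. F [h 0, h i, h j] = 0 \<and> (\<forall>k\<in>{1..5}. F [h i, h j, h k] = 0)"
      "\<forall>i\<in>{1..5}. F [h 0, h i, h 5] = 0" by blast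
    then show "\<exists>F1 F2. simple_form 3 F1 \<and> simple_form 3 F2 \<and> orthogonal_forms B F1 F2 \<and> F = F1 + F2"
      by (intro adapted_frame_decomposition[OF assms(1,2) _ assms(4) J]) blast+
  next
    assume "\<exists>F1 F2. simple_form 3 F1 \<and> simple_form 3 F2 \<and> orthogonal_forms B F1 F2 \<and> F = F1 + F2"
    then obtain F1 F2 where F12: "simple_form 3 F1" "simple_form 3 F2" "orthogonal_forms B F1 F2"
        "F = F1 + F2"
      by blast
    obtain a1 a2 a3 b1 b2 b3 where "F1 = wedge_list [B a1, B a2, B a3]"
        "F2 = wedge_list [B b1, B b2, B b3]"
        "\<And>a b. a \<in> {a1, a2, a3} \<Longrightarrow> b \<in> {b1, b2, b3} \<Longrightarrow> B a b = 0"
      by (rule orthogonal_simple_formsE[OF assms(2) pos F12(1-3)]) blast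
    then show "\<forall>X. bracket B (\<iota> X F) F = 0"
      unfolding F12(4) by (intro allI bracket_orthogonal_simple_eq_zero[OF assms(2) pos])
  qed
qed

end
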